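(* For every $k\in\mathbb{R}^3$, the plane wave $\varphi_0(x,k)=e^{ix\cdot k}$ satisfies $$\sqrt{-\Delta_x}\,\varphi_0(x,k)=|k|\,\varphi_0(x,k)\quad\text{in }\mathcal{S}'(\mathbb{R}^3_x).$$
   Context: $L^{2,s}(\mathbb{R}^3)=\{f:(1+|x|^2)^{s/2}f\in L^2\}$. Meaning of $\sqrt{-\Delta}u$: for $\psi\in\mathcal{S}(\mathbb{R}^3)$ one has $\sqrt{-\Delta}\,\psi=\mathcal{F}^{-1}(|\xi|\mathcal{F}\psi)\in L^{2,t}(\mathbb{R}^3)$ for every $t<5/2$; hence for $u\in L^{2,s}(\mathbb{R}^3)$ with $s>-5/2$ the tempered distribution $\sqrt{-\Delta}u$ is defined by $\langle\sqrt{-\Delta}u,\psi\rangle=\int_{\mathbb{R}^3}u(x)\,(\sqrt{-\Delta}\,\psi)(x)\,dx$. This applies to $\varphi_0(\cdot,k)$, which belongs to $L^{2,s}(\mathbb{R}^3)$ for every $s<-3/2$. *)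

theory Defs
  imports "HOL-Analysis.Analysis"
begin

section \<open>Schwartz space\<close>

definition partial_deriv :: "3 \<Rightarrow> (real^3 \<Rightarrow> complex) \<Rightarrow> real^3 \<Rightarrow> complex" where
  "partial_deriv i f x = frechet_derivative f (at x) (axis i 1)"

text \<open>Higher partial derivatives are indexed by lists of directions rather than by multi-indices;
  on smooth functions the order of the list is immaterial, so both index the same family.\<close>

definition partial_derivs :: "3 list \<Rightarrow> (real^3 \<Rightarrow> complex) \<Rightarrow> real^3 \<Rightarrow> complex" where
  "partial_derivs js f = foldr partial_deriv js f"

definition smooth :: "(real^3 \<Rightarrow> complex) \<Rightarrow> bool" where
  "smooth f \<longleftrightarrow> (\<forall>js x. partial_derivs js f differentiable (at x))"

definition monomial :: "(3 \<Rightarrow> nat) \<Rightarrow> real^3 \<Rightarrow> real" where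
  "monomial \<alpha> x = (\<Prod>i\<in>UNIV. (x $ i) ^ \<alpha> i)"

definition schwartz :: "(real^3 \<Rightarrow> complex) set" where
  "schwartz = {f. smooth f \<and>
     (\<forall>\<alpha> js. bdd_above (range (\<lambda>x. norm (monomial \<alpha> x *\<^sub>R partial_derivs js f x))))}"

definition schwartz_seminorm :: "(3 \<Rightarrow> nat) \<Rightarrow> 3 list \<Rightarrow> (real^3 \<Rightarrow> complex) \<Rightarrow> real" where
  "schwartz_seminorm \<alpha> js f = (SUP x. norm (monomial \<alpha> x *\<^sub>R partial_derivs js f x))"

text \<open>The locally convex topology of the family of seminorms.\<close>

definition schwartz_topology :: "(real^3 \<Rightarrow> complex) topology" where
  "schwartz_topology = topology_generated_by
     {{g \<in> schwartz. schwartz_seminorm \<alpha> js (\<lambda>x. g x - f x) < e} | \<alpha> js f e. f \<in> schwartz \<and> 0 < e}"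


section \<open>Tempered distributions\<close>

text \<open>Functionals are \<^const>\<open>undefined\<close> outside \<^const>\<open>schwartz\<close>, so that equality
  in the dual space is equality in HOL.\<close>

definition tempered_distributions :: "((real^3 \<Rightarrow> complex) \<Rightarrow> complex) set" where
  "tempered_distributions = {T \<in> extensional schwartz.
     (\<forall>f\<in>schwartz. \<forall>g\<in>schwartz. T (\<lambda>x. f x + g x) = T f + T g) \<and>
     (\<forall>c. \<forall>f\<in>schwartz. T (\<lambda>x. c * f x) = c * T f) \<and>
     continuous_map schwartz_topology euclidean T}"

definition regular_distr :: "(real^3 \<Rightarrow> complex) \<Rightarrow> (real^3 \<Rightarrow> complex) \<Rightarrow> complex" where
  "regular_distr u = (\<lambda>\<psi>\<in>schwartz. LINT x|lebesgue. u x * \<psi> x)"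


section \<open>Weighted \<open>L\<^sup>2\<close> spaces\<close>

definition square_integrable :: "(real^3 \<Rightarrow> complex) \<Rightarrow> bool" where
  "square_integrable f \<longleftrightarrow>
     f \<in> borel_measurable lebesgue \<and> integrable lebesgue (\<lambda>x. (norm (f x))\<^sup>2)"

definition weighted_L2 :: "real \<Rightarrow> (real^3 \<Rightarrow> complex) set" where
  "weighted_L2 s = {f. square_integrable (\<lambda>x. (1 + (norm x)\<^sup>2) powr (s / 2) *\<^sub>R f x)}"


section \<open>The operator \<open>\<surd>(-\<Delta>)\<close>\<close>

text \<open>The unitary normalisation of the Fourier transform. Only the frequency convention
  \<open>exp (\<mp>\<i>x\<cdot>\<xi>)\<close>, without a factor \<open>2\<pi>\<close>, affects the operator below: the constants cancel.\<close>

definition fourier :: "(real^3 \<Rightarrow> complex) \<Rightarrow> real^3 \<Rightarrow> complex" where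
  "fourier f \<xi> = complex_of_real ((2 * pi) powr (-3/2)) *
     (LINT x|lebesgue. exp (- \<i> * complex_of_real (x \<bullet> \<xi>)) * f x)"

definition inverse_fourier :: "(real^3 \<Rightarrow> complex) \<Rightarrow> real^3 \<Rightarrow> complex" where
  "inverse_fourier g x = complex_of_real ((2 * pi) powr (-3/2)) *
     (LINT \<xi>|lebesgue. exp (\<i> * complex_of_real (x \<bullet> \<xi>)) * g \<xi>)"

definition sqrt_neg_laplacian :: "(real^3 \<Rightarrow> complex) \<Rightarrow> real^3 \<Rightarrow> complex" where
  "sqrt_neg_laplacian \<psi> = inverse_fourier (\<lambda>\<xi>. complex_of_real (norm \<xi>) * fourier \<psi> \<xi>)"

text \<open>The extension by duality, meaningful for \<open>u\<close> in some \<open>weighted_L2 s\<close> with \<open>s > -5/2\<close>.\<close>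

definition sqrt_neg_laplacian_distr :: "(real^3 \<Rightarrow> complex) \<Rightarrow> (real^3 \<Rightarrow> complex) \<Rightarrow> complex" where
  "sqrt_neg_laplacian_distr u = (\<lambda>\<psi>\<in>schwartz. LINT x|lebesgue. u x * sqrt_neg_laplacian \<psi> x)"

definition plane_wave :: "real^3 \<Rightarrow> real^3 \<Rightarrow> complex" where
  "plane_wave k x = exp (\<i> * complex_of_real (x \<bullet> k))"

end

theory Submission
  imports Defs "HOL-Probability.Sinc_Integral" "HOL-Probability.Characteristic_Functions"
    "HOL-Real_Asymp.Real_Asymp"
begin

text \<open>Since the plane wave is bounded, everything rests on \<open>\<surd>(-\<Delta>) \<psi> \<in> L\<^sup>1\<close>. Up to a constant,
  \<open>\<bar>\<xi>\<bar>\<close> is the integral over \<open>r \<in> \<real>\<close> of \<open>(1 - exp (- r\<^sup>2\<bar>\<xi>\<bar>\<^sup>2 / 2)) / r\<^sup>2\<close>, so that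
  \<open>\<surd>(-\<Delta>) \<psi>\<close> is the integral of \<open>(\<psi> - H\<^sub>r \<psi>) / r\<^sup>2\<close>, where \<open>H\<^sub>r\<close> is averaging against a Gaussian of
  standard deviation \<open>r\<close>. Averaging contracts \<open>L\<^sup>1\<close>, and \<open>\<psi> - H\<^sub>r \<psi>\<close> is \<open>r\<^sup>2\<close> times an average of
  \<open>- H\<^sub>s \<Delta>\<psi>\<close> with \<open>0 \<le> s \<le> r\<close>, so the integrand has \<open>L\<^sup>1\<close> norm \<open>O(1 / (1 + r\<^sup>2))\<close>. By Fubini,
  \<open>\<surd>(-\<Delta>) \<psi>\<close> is integrable and may be paired with \<open>exp (\<i> x\<cdot>k)\<close> under the \<open>r\<close>-integral, where each
  \<open>H\<^sub>r\<close> acts as multiplication by \<open>exp (- r\<^sup>2\<bar>k\<bar>\<^sup>2 / 2)\<close>; the result is \<open>\<bar>k\<bar>\<close>.\<close>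

section \<open>Integration on Euclidean space\<close>

text \<open>\<open>lborel\<close> is the image of a finite product of one-dimensional Lebesgue
  measures under the coordinate map, so integrals of products of one-variable functions factor. Used
  for the Gaussian and for product weights that serve as dominating functions.\<close>

lemma lborel_integral_prod:
  fixes f :: "'a::euclidean_space \<Rightarrow> real \<Rightarrow> 'c::{real_normed_field,banach,second_countable_topology}"
  assumes "\<And>b. b \<in> Basis \<Longrightarrow> integrable lborel (f b)"
  shows "integrable lborel (\<lambda>x::'a. \<Prod>b\<in>Basis. f b (x \<bullet> b))"
    and "(LINT x|lborel. (\<Prod>b\<in>Basis. f b (x \<bullet> b))) = (\<Prod>b\<in>Basis. (LINT t|lborel. f b t))"
proof -
  interpret product_sigma_finite "\<lambda>_::'a. lborel :: real measure" ..
  have [measurable]: "\<And>b. b \<in> Basis \<Longrightarrow> f b \<in> borel_measurable borel"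
    using borel_measurable_integrable[OF assms] by simp
  have eq: "(\<Prod>b\<in>Basis. f b ((\<Sum>c\<in>Basis. x c *\<^sub>R c) \<bullet> b)) = (\<Prod>b\<in>Basis. f b (x b))"
    for x :: "'a \<Rightarrow> real"
    by (intro prod.cong refl) simp
  have meas: "(\<lambda>x. \<Prod>b\<in>Basis. f b (x \<bullet> b)) \<in> borel_measurable borel"
    "(\<lambda>x. \<Sum>b\<in>Basis. x b *\<^sub>R b) \<in> (\<Pi>\<^sub>M b\<in>Basis. lborel) \<rightarrow>\<^sub>M (borel :: 'a measure)"
    by measurable
  show "integrable lborel (\<lambda>x::'a. \<Prod>b\<in>Basis. f b (x \<bullet> b))"
    unfolding lborel_eq[where 'a='a] integrable_distr_eq[OF meas(2,1)] eq
    by (intro product_integrable_prod assms) auto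
  show "(LINT x|lborel. (\<Prod>b\<in>Basis. f b (x \<bullet> b))) = (\<Prod>b\<in>Basis. (LINT t|lborel. f b t))"
    unfolding lborel_eq[where 'a='a] integral_distr[OF meas(2,1)] eq
    by (intro product_integral_prod assms) auto
qed

lemma lborel_integral_translate:
  fixes f :: "'a::euclidean_space \<Rightarrow> 'b::{banach,second_countable_topology}"
  assumes [measurable]: "f \<in> borel_measurable borel"
  shows "integrable lborel (\<lambda>x. f (x + a)) \<longleftrightarrow> integrable lborel f"
    and "(LINT x|lborel. f (x + a)) = (LINT x|lborel. f x)"
proof -
  show "integrable lborel (\<lambda>x. f (x + a)) \<longleftrightarrow> integrable lborel f"
    by (subst (2) lborel_distr_plus[of a, symmetric], subst integrable_distr_eq)
      (auto simp: add.commute)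
  show "(LINT x|lborel. f (x + a)) = (LINT x|lborel. f x)"
    by (subst (2) lborel_distr_plus[of a, symmetric], subst integral_distr)
      (auto simp: add.commute)
qed

lemma lborel_integral_affine:
  fixes f :: "'a::euclidean_space \<Rightarrow> 'b::{banach,second_countable_topology}"
  assumes [measurable]: "f \<in> borel_measurable borel" and "c \<noteq> 0"
  shows "(LINT x|lborel. f x) = \<bar>c\<bar> ^ DIM('a) *\<^sub>R (LINT x|lborel. f (t + c *\<^sub>R x))"
    and "integrable lborel f \<longleftrightarrow> integrable lborel (\<lambda>x. f (t + c *\<^sub>R x))"
proof -
  let ?D = "distr lborel borel (\<lambda>x. t + c *\<^sub>R x)"
  have "(LINT x|lborel. f x) = (LINT x|density ?D (\<lambda>_. ennreal (\<bar>c\<bar> ^ DIM('a))). f x)"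
    using lborel_affine[OF \<open>c \<noteq> 0\<close>, of t] by simp
  also have "\<dots> = \<bar>c\<bar> ^ DIM('a) *\<^sub>R (LINT x|?D. f x)"
    by (subst integral_density) auto
  finally show "(LINT x|lborel. f x) = \<bar>c\<bar> ^ DIM('a) *\<^sub>R (LINT x|lborel. f (t + c *\<^sub>R x))"
    by (simp add: integral_distr)
  have "integrable lborel f \<longleftrightarrow> integrable (density ?D (\<lambda>_. ennreal (\<bar>c\<bar> ^ DIM('a)))) f"
    using lborel_affine[OF \<open>c \<noteq> 0\<close>, of t] by simp
  also have "\<dots> \<longleftrightarrow> integrable ?D (\<lambda>x. \<bar>c\<bar> ^ DIM('a) *\<^sub>R f x)"
    by (subst integrable_density) auto
  also have "\<dots> \<longleftrightarrow> integrable ?D f"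
    using \<open>c \<noteq> 0\<close>
      integrable_scaleR_right[of "inverse (\<bar>c\<bar> ^ DIM('a))" ?D "\<lambda>x. \<bar>c\<bar> ^ DIM('a) *\<^sub>R f x"]
    by auto
  finally show "integrable lborel f \<longleftrightarrow> integrable lborel (\<lambda>x. f (t + c *\<^sub>R x))"
    by (simp add: integrable_distr_eq)
qed

text \<open>The integrand is dominated by \<open>B\<close> times the norm of f(x) g(y), which is
  integrable on the product. The oscillatory integrals below are arranged in this form: characters
  and bounded weights go into \<open>K\<close>, decaying factors into \<open>f\<close> and
  \<open>g\<close>.\<close>

lemma integrable_bounded_kernel:
  fixes f :: "'a::euclidean_space \<Rightarrow> complex" and g :: "'b::euclidean_space \<Rightarrow> complex"
  assumes f: "integrable lborel f" and g: "integrable lborel g"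
    and [measurable]: "case_prod K \<in> borel_measurable (lborel \<Otimes>\<^sub>M lborel)"
    and K: "\<And>x y. norm (K x y) \<le> B"
  shows "integrable (lborel \<Otimes>\<^sub>M lborel) (\<lambda>(x, y). K x y * (f x * g y))"
proof -
  have [measurable]: "f \<in> borel_measurable borel" "g \<in> borel_measurable borel"
    using borel_measurable_integrable[OF f] borel_measurable_integrable[OF g] by auto
  have "integrable (lborel \<Otimes>\<^sub>M lborel) (\<lambda>(x, y). f x * g y)"
  proof (rule lborel_pair.Fubini_integrable)
    show "integrable lborel (\<lambda>x. LINT y|lborel. norm (case (x, y) of (x, y) \<Rightarrow> f x * g y))"
      using f g by (simp add: norm_mult)
  qed (use g in auto)
  then have "integrable (lborel \<Otimes>\<^sub>M lborel) (\<lambda>p. B * norm (case p of (x, y) \<Rightarrow> f x * g y))"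
    by auto
  then show ?thesis
  proof (rule Bochner_Integration.integrable_bound, goal_cases)
    case 2
    have "B \<ge> 0" using K[of 0 0] norm_ge_zero order_trans by blast
    then show ?case
      by (intro AE_I2) (auto simp: norm_mult abs_mult split: prod.split intro!: mult_right_mono K)
  qed auto
qed

lemma Fubini_bounded_kernel:
  fixes f :: "'a::euclidean_space \<Rightarrow> complex" and g :: "'b::euclidean_space \<Rightarrow> complex"
  assumes "integrable lborel f" "integrable lborel g"
    and "case_prod K \<in> borel_measurable (lborel \<Otimes>\<^sub>M lborel)"
    and "\<And>x y. norm (K x y) \<le> B"
  shows "(LINT x|lborel. LINT y|lborel. K x y * (f x * g y)) =
    (LINT y|lborel. LINT x|lborel. K x y * (f x * g y))"
  using lborel_pair.Fubini_integral[OF integrable_bounded_kernel[OF assms]] by simp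

section \<open>Gaussian averages\<close>

text \<open>The product form reduces integrals to the one-dimensional normal density;
  \<open>gauss_eq\<close> recovers the radial formula.\<close>

definition gauss :: "'a::euclidean_space \<Rightarrow> real" where
  "gauss z = (\<Prod>b\<in>Basis. std_normal_density (z \<bullet> b))"

lemma gauss_eq:
  "gauss (z::'a::euclidean_space) = (2 * pi) powr (- real DIM('a) / 2) * exp (- (norm z)\<^sup>2 / 2)"
proof -
  have "(\<Prod>b\<in>(Basis::'a set). 1 / sqrt (2 * pi)) = (2 * pi) powr (- real DIM('a) / 2)"
  proof -
    have "(2 * pi) powr (- real DIM('a) / 2) = inverse (((2 * pi) powr (1 / 2)) powr (real DIM('a)))"
      by (simp only: powr_powr flip: powr_minus) simp
    also have "\<dots> = inverse (sqrt (2 * pi) ^ DIM('a))"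
      by (subst powr_realpow) (auto simp: powr_half_sqrt)
    finally show ?thesis
      by (simp add: power_divide inverse_eq_divide)
  qed
  moreover have "(norm z)\<^sup>2 = (\<Sum>b\<in>Basis. (z \<bullet> b)\<^sup>2)"
    by (subst power2_norm_eq_inner, subst euclidean_inner) (simp add: power2_eq_square)
  ultimately show ?thesis
    by (simp only: gauss_def std_normal_density_def prod.distrib)
      (simp add: sum_divide_distrib flip: exp_sum sum_negf)
qed

lemma gauss_nonneg [simp]: "gauss z \<ge> 0"
  by (simp add: gauss_eq)

lemma measurable_gauss [measurable]: "gauss \<in> borel_measurable borel"
  unfolding gauss_def by measurable

lemma measurable_cis [measurable]: "cis \<in> borel_measurable borel"
  by (intro borel_measurable_continuous_onI continuous_intros)

lemma integrable_gauss: "integrable lborel gauss"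
  unfolding gauss_def by (rule lborel_integral_prod) simp

text \<open>Both factors split over coordinates, and each one-dimensional integral is the
  characteristic function of the standard normal distribution.\<close>

lemma gauss_integral_cis:
  "(LINT z|lborel. gauss z *\<^sub>R cis (z \<bullet> v)) = of_real (exp (- (norm (v::'a::euclidean_space))\<^sup>2 / 2))"
proof -
  have 1: "(LINT t|lborel. std_normal_density t *\<^sub>R cis (t * s)) = of_real (exp (- s\<^sup>2 / 2))" for s
    using fun_cong[OF char_std_normal_distribution, of s]
    by (simp add: char_def integral_density cis_conv_exp mult.commute scaleR_conv_of_real)
  have 2: "integrable lborel (\<lambda>t. std_normal_density t *\<^sub>R cis (t * s))" for s
    by (rule Bochner_Integration.integrable_bound[of lborel std_normal_density]) auto
  have "gauss z *\<^sub>R cis (z \<bullet> v) =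
      (\<Prod>b\<in>Basis. std_normal_density (z \<bullet> b) *\<^sub>R cis ((z \<bullet> b) * (v \<bullet> b)))" for z
    by (subst euclidean_inner)
      (simp add: gauss_def cis_conv_exp sum_distrib_left exp_sum scaleR_conv_of_real prod.distrib)
  then have "(LINT z|lborel. gauss z *\<^sub>R cis (z \<bullet> v)) =
      (\<Prod>b\<in>Basis. (LINT t|lborel. std_normal_density t *\<^sub>R cis (t * (v \<bullet> b))))"
    using lborel_integral_prod(2)[OF 2] by simp
  moreover have "(norm v)\<^sup>2 = (\<Sum>b\<in>Basis. (v \<bullet> b)\<^sup>2)"
    by (subst power2_norm_eq_inner, subst euclidean_inner) (simp add: power2_eq_square)
  ultimately show ?thesis
    by (simp add: 1 exp_sum sum_divide_distrib flip: sum_negf)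
qed

lemma integral_gauss: "(LINT z|(lborel :: 'a::euclidean_space measure). gauss z) = 1"
proof -
  have "complex_of_real (LINT z|(lborel :: 'a measure). gauss z) = 1"
    using gauss_integral_cis[of "0::'a"] by (simp add: scaleR_conv_of_real)
  then show ?thesis
    using of_real_eq_1_iff by blast
qed

text \<open>Up to powers of 2 pi the Gaussian is its own Fourier transform, so
  \<open>gauss_integral_cis\<close> can be read in either direction. This is the special case on
  which Fourier inversion rests.\<close>

lemma gauss_cis_integral:
  "(LINT z|lborel. exp (- (norm z)\<^sup>2 / 2) *\<^sub>R cis (z \<bullet> v)) =
    of_real ((2 * pi) ^ DIM('a) * gauss (v::'a::euclidean_space))"
proof -
  have 1: "exp (- (norm z)\<^sup>2 / 2) = (2 * pi) powr (real DIM('a) / 2) * gauss z" for z :: 'a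
    by (simp add: gauss_eq powr_minus field_simps)
  have 2: "(2 * pi) ^ DIM('a) = (2 * pi) powr (real DIM('a) / 2) * (2 * pi) powr (real DIM('a) / 2)"
    unfolding powr_add[symmetric] by (simp add: powr_realpow)
  have 3: "(2 * pi) ^ DIM('a) * gauss v = (2 * pi) powr (real DIM('a) / 2) * exp (- (norm v)\<^sup>2 / 2)"
    by (simp only: gauss_eq 2) (simp add: powr_minus)
  show ?thesis
    unfolding 1 scaleR_scaleR[symmetric] integral_scaleR_right gauss_integral_cis 3
    by (simp add: scaleR_conv_of_real)
qed

lemma gauss_cis_integral_scaled:
  assumes "r \<noteq> 0"
  shows "(LINT z|lborel. exp (- r\<^sup>2 * (norm z)\<^sup>2 / 2) *\<^sub>R cis (z \<bullet> v)) =
    of_real ((2 * pi / \<bar>r\<bar>) ^ DIM('a) * gauss ((v::'a::euclidean_space) /\<^sub>R r))"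
proof -
  have "(LINT z|lborel. exp (- (norm z)\<^sup>2 / 2) *\<^sub>R cis (z \<bullet> (v /\<^sub>R r))) =
     \<bar>r\<bar> ^ DIM('a) *\<^sub>R (LINT z|lborel. exp (- r\<^sup>2 * (norm z)\<^sup>2 / 2) *\<^sub>R cis (z \<bullet> v))"
    using assms
    by (subst lborel_integral_affine[where c = r and t = 0])
      (auto simp: power_mult_distrib simp flip: mult.assoc[of "inverse r"])
  then show ?thesis
    using assms unfolding gauss_cis_integral
    by (auto simp: scaleR_conv_of_real field_simps)
qed

lemma gauss_uminus [simp]: "gauss (- z) = gauss z"
  by (simp add: gauss_eq)

lemma integrable_exp_norm_power2:
  assumes "r \<noteq> 0"
  shows "integrable lborel (\<lambda>z::'a::euclidean_space. exp (- r\<^sup>2 * (norm z)\<^sup>2 / 2))"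
proof -
  have "(\<lambda>z::'a. exp (- r\<^sup>2 * (norm z)\<^sup>2 / 2)) =
      (\<lambda>z. (2 * pi) powr (real DIM('a) / 2) * gauss (0 + r *\<^sub>R z))"
    by (simp add: gauss_eq powr_minus field_simps power_mult_distrib)
  moreover have "integrable lborel (\<lambda>z::'a. gauss (0 + r *\<^sub>R z))"
    using lborel_integral_affine(2)[OF measurable_gauss assms, of 0] integrable_gauss by blast
  ultimately show ?thesis
    by simp
qed

section \<open>The Fourier transform and Gaussian averaging on integrable functions\<close>

text \<open>Left unnormalised; \<open>fourier_eq_ft\<close> and \<open>sqrt_neg_laplacian_eq\<close>
  restore the constants.\<close>

definition ft :: "('a::euclidean_space \<Rightarrow> complex) \<Rightarrow> 'a \<Rightarrow> complex" where
  "ft f \<xi> = (LINT x|lborel. cis (- (x \<bullet> \<xi>)) * f x)"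

text \<open>This is the heat flow at time r^2/2. With the standard deviation as parameter,
  \<open>r\<close> can range over the whole line, and r = 0 gives the identity.\<close>

definition heat :: "real \<Rightarrow> ('a::euclidean_space \<Rightarrow> complex) \<Rightarrow> 'a \<Rightarrow> complex" where
  "heat r f x = (LINT z|lborel. gauss z *\<^sub>R f (x + r *\<^sub>R z))"

lemma integrable_cis_mult:
  assumes "integrable lborel f" and [measurable]: "g \<in> borel_measurable lborel"
  shows "integrable lborel (\<lambda>x. cis (g x) * f x)"
proof -
  have [measurable]: "f \<in> borel_measurable lborel"
    using assms by auto
  show ?thesis
    by (rule Bochner_Integration.integrable_bound[OF assms(1)]) (auto simp: norm_mult)
qed

lemma measurable_ft [measurable]:
  assumes [measurable]: "f \<in> borel_measurable borel"
  shows "ft f \<in> borel_measurable borel"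
proof -
  have "(\<lambda>\<xi>. LINT x|lborel. cis (- (x \<bullet> \<xi>)) * f x) \<in> borel_measurable borel"
    by measurable
  then show ?thesis
    unfolding ft_def[abs_def] .
qed

lemma norm_ft_le: "norm (ft f \<xi>) \<le> (LINT x|lborel. norm (f x))"
  unfolding ft_def using integral_norm_bound[of lborel "\<lambda>x. cis (- (x \<bullet> \<xi>)) * f x"]
  by (simp add: norm_mult)

lemma measurable_heat [measurable]:
  assumes [measurable]: "f \<in> borel_measurable borel"
  shows "(\<lambda>(r, x). heat r f x) \<in> borel_measurable (borel \<Otimes>\<^sub>M borel)"
  unfolding heat_def by measurable

lemma heat_0: "heat 0 f x = f x"
  by (simp add: heat_def integral_gauss integrable_gauss)

context
  fixes f :: "'a::euclidean_space \<Rightarrow> complex"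
  assumes f: "integrable lborel f"
begin

private lemma measurable_f [measurable]: "f \<in> borel_measurable borel"
  using borel_measurable_integrable[OF f] by simp

lemma integrable_translate: "integrable lborel (\<lambda>x. f (x + a))"
  using f by (simp add: lborel_integral_translate)

text \<open>Integrating in \<open>x\<close> first, translation invariance turns the inner integral
  of the norm into \<open>gauss z\<close> times the L1 norm of \<open>f\<close>. Fubini in the other
  order then yields \<open>integrable_heat\<close>.\<close>

lemma integrable_heat_pair:
  "integrable (lborel \<Otimes>\<^sub>M lborel) (\<lambda>(z, x). gauss z *\<^sub>R f (x + r *\<^sub>R z))"
proof (rule lborel_pair.Fubini_integrable)
  have "(LINT x|lborel. norm (gauss z *\<^sub>R f (x + r *\<^sub>R z))) = gauss z * (LINT x|lborel. norm (f x))" for z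
    using lborel_integral_translate(2)[of "\<lambda>x. norm (f x)" "r *\<^sub>R z"] by simp
  then show "integrable lborel (\<lambda>z. LINT x|lborel. norm (case (z, x) of (z, x) \<Rightarrow> gauss z *\<^sub>R f (x + r *\<^sub>R z)))"
    by (simp only: prod.case) (intro integrable_mult_left integrable_gauss)
  show "AE z in lborel. integrable lborel (\<lambda>x. case (z, x) of (z, x) \<Rightarrow> gauss z *\<^sub>R f (x + r *\<^sub>R z))"
    by (simp add: integrable_translate)
qed measurable

lemma integrable_heat: "integrable lborel (heat r f)"
  using lborel_pair.integrable_snd[OF integrable_heat_pair] by (simp add: heat_def[abs_def])

text \<open>The norm goes under the Gaussian integral; after exchanging the order, every translate
  has the L1 norm of \<open>f\<close>, and the Gaussian has mass 1.\<close>

lemma integral_norm_heat_le: "(LINT x|lborel. norm (heat r f x)) \<le> (LINT x|lborel. norm (f x))"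
proof -
  have int: "integrable (lborel \<Otimes>\<^sub>M lborel) (\<lambda>(z, x). norm (gauss z *\<^sub>R f (x + r *\<^sub>R z)))"
    using integrable_norm[OF integrable_heat_pair[of r]] by (simp add: case_prod_beta')
  have "(LINT x|lborel. norm (heat r f x)) \<le>
      (LINT x|lborel. LINT z|lborel. norm (gauss z *\<^sub>R f (x + r *\<^sub>R z)))"
    unfolding heat_def
    by (intro integral_mono integral_norm_bound lborel_pair.integrable_snd[OF int] integrable_norm
        integrable_heat[unfolded heat_def[abs_def]])
  also have "\<dots> = (LINT z|lborel. LINT x|lborel. norm (gauss z *\<^sub>R f (x + r *\<^sub>R z)))"
    by (rule lborel_pair.Fubini_integral[OF int])
  also have "\<dots> = (LINT z|(lborel::'a measure). gauss z * (LINT x|lborel. norm (f x)))"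
    using lborel_integral_translate(2)[of "\<lambda>x. norm (f x)"] by simp
  also have "\<dots> = (LINT x|lborel. norm (f x))"
    by (simp add: integral_gauss integrable_gauss)
  finally show ?thesis .
qed

text \<open>Each translate in the average multiplies the transform by the character
  \<open>cis (z \<bullet> (r *\<^sub>R \<xi>))\<close>; averaging these characters gives the
  Gaussian's characteristic function at r \<xi>.\<close>

lemma ft_heat: "ft (heat r f) \<xi> = exp (- r\<^sup>2 * (norm \<xi>)\<^sup>2 / 2) *\<^sub>R ft f \<xi>"
proof -
  let ?F = "\<lambda>z x. cis (- (x \<bullet> \<xi>)) * (gauss z *\<^sub>R f (x + r *\<^sub>R z))"
  have "integrable (lborel \<Otimes>\<^sub>M lborel) (\<lambda>(z, x). ?F z x)"
    by (rule Bochner_Integration.integrable_bound[OF integrable_heat_pair[of r]])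
      (auto simp: norm_mult)
  note Fub = lborel_pair.Fubini_integral[OF this]
  have inner: "(LINT x|lborel. ?F z x) = (gauss z *\<^sub>R cis (z \<bullet> (r *\<^sub>R \<xi>))) * ft f \<xi>" for z
  proof -
    have "(LINT x|lborel. ?F z x) = (LINT x|lborel. gauss z *\<^sub>R cis (- ((x - r *\<^sub>R z) \<bullet> \<xi>)) * f x)"
      using lborel_integral_translate(2)
          [of "\<lambda>x. gauss z *\<^sub>R cis (- ((x - r *\<^sub>R z) \<bullet> \<xi>)) * f x" "r *\<^sub>R z"]
      by (simp add: ac_simps)
    also have "\<dots> = (LINT x|lborel. (gauss z *\<^sub>R cis (z \<bullet> (r *\<^sub>R \<xi>))) * (cis (- (x \<bullet> \<xi>)) * f x))"
      by (simp add: inner_diff_left cis_mult mult.assoc[symmetric] add.commute)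
    finally show ?thesis
      by (simp add: ft_def)
  qed
  have "ft (heat r f) \<xi> = (LINT x|lborel. LINT z|lborel. ?F z x)"
    by (simp only: ft_def heat_def integral_mult_right_zero[symmetric])
  also have "\<dots> = (LINT z|lborel. (gauss z *\<^sub>R cis (z \<bullet> (r *\<^sub>R \<xi>))) * ft f \<xi>)"
    unfolding Fub inner ..
  also have "\<dots> = (LINT z|lborel. (gauss z *\<^sub>R cis (z \<bullet> (r *\<^sub>R \<xi>)))) * ft f \<xi>"
    by (rule integral_mult_left_zero)
  finally show ?thesis
    unfolding gauss_integral_cis by (simp add: scaleR_conv_of_real power_mult_distrib)
qed

text \<open>Inversion with a Gaussian cutoff in place of integrability of \<open>ft f\<close>: the
  cutoff makes the double integral absolutely convergent, and exchanging the order leaves the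
  transform of the cutoff, a Gaussian kernel centred at \<open>x\<close>.\<close>

lemma heat_inversion:
  assumes "r \<noteq> 0"
  shows "(LINT \<xi>|lborel. cis (x \<bullet> \<xi>) * (exp (- r\<^sup>2 * (norm \<xi>)\<^sup>2 / 2) *\<^sub>R ft f \<xi>)) =
    (2 * pi) ^ DIM('a) *\<^sub>R heat r f x"
proof -
  let ?E = "\<lambda>\<xi>::'a. complex_of_real (exp (- r\<^sup>2 * (norm \<xi>)\<^sup>2 / 2))"
  have "(LINT \<xi>|lborel. cis (x \<bullet> \<xi>) * (exp (- r\<^sup>2 * (norm \<xi>)\<^sup>2 / 2) *\<^sub>R ft f \<xi>)) =
      (LINT \<xi>|lborel. LINT y|lborel. cis ((x - y) \<bullet> \<xi>) * (?E \<xi> * f y))"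
    unfolding ft_def
  proof (intro Bochner_Integration.integral_cong refl)
    fix \<xi> :: 'a
    have "cis (x \<bullet> \<xi>) * (exp (- r\<^sup>2 * (norm \<xi>)\<^sup>2 / 2) *\<^sub>R (LINT y|lborel. cis (- (y \<bullet> \<xi>)) * f y)) =
        (LINT y|lborel. (cis (x \<bullet> \<xi>) * ?E \<xi>) * (cis (- (y \<bullet> \<xi>)) * f y))"
      unfolding integral_mult_right_zero by (simp add: scaleR_conv_of_real)
    also have "\<dots> = (LINT y|lborel. cis ((x - y) \<bullet> \<xi>) * (?E \<xi> * f y))"
      by (intro Bochner_Integration.integral_cong refl)
        (simp add: inner_diff_left cis_mult flip: mult.assoc)
    finally show "cis (x \<bullet> \<xi>) * (exp (- r\<^sup>2 * (norm \<xi>)\<^sup>2 / 2) *\<^sub>R (LINT y|lborel. cis (- (y \<bullet> \<xi>)) * f y)) =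
      (LINT y|lborel. cis ((x - y) \<bullet> \<xi>) * (?E \<xi> * f y))" .
  qed
  also have "\<dots> = (LINT y|lborel. LINT \<xi>|lborel. cis ((x - y) \<bullet> \<xi>) * (?E \<xi> * f y))"
  proof (rule Fubini_bounded_kernel[OF integrable_of_real[OF integrable_exp_norm_power2[OF assms]] f])
    show "norm (cis ((x - y) \<bullet> \<xi>)) \<le> 1" for y \<xi>
      by simp
  qed measurable
  also have "\<dots> = (LINT y|lborel. ((2 * pi / \<bar>r\<bar>) ^ DIM('a) * gauss ((x - y) /\<^sub>R r)) *\<^sub>R f y)"
  proof (intro Bochner_Integration.integral_cong refl)
    fix y
    have "(LINT \<xi>|lborel. cis ((x - y) \<bullet> \<xi>) * (?E \<xi> * f y)) =
        (LINT \<xi>|lborel. (exp (- r\<^sup>2 * (norm \<xi>)\<^sup>2 / 2) *\<^sub>R cis (\<xi> \<bullet> (x - y))) * f y)"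
      by (intro Bochner_Integration.integral_cong refl)
        (simp add: scaleR_conv_of_real inner_commute)
    then show "(LINT \<xi>|lborel. cis ((x - y) \<bullet> \<xi>) * (?E \<xi> * f y)) =
        ((2 * pi / \<bar>r\<bar>) ^ DIM('a) * gauss ((x - y) /\<^sub>R r)) *\<^sub>R f y"
      unfolding integral_mult_left_zero gauss_cis_integral_scaled[OF assms]
      by (simp add: scaleR_conv_of_real)
  qed
  \<comment> \<open>Substitution y = x + r z: the Jacobian cancels the power of |r|, and evenness of
    \<open>gauss\<close> absorbs the sign.\<close>
  also have "\<dots> = (LINT z|lborel. ((2 * pi) ^ DIM('a) * gauss z) *\<^sub>R f (x + r *\<^sub>R z))"
    using assms
  proof -
    have "\<bar>r\<bar> ^ DIM('a) *\<^sub>R (((2 * pi / \<bar>r\<bar>) ^ DIM('a) * g) *\<^sub>R w) = ((2 * pi) ^ DIM('a) * g) *\<^sub>R w"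
      for g and w :: complex
      using assms by (simp add: power_divide)
    moreover have "inverse r *\<^sub>R r *\<^sub>R v = v" for v :: 'a
      using assms by simp
    ultimately show ?thesis
      using assms
      by (subst lborel_integral_affine[OF _ assms, of _ x])
        (measurable, simp del: scaleR_scaleR flip: integral_scaleR_right)
  qed
  finally show ?thesis
    by (simp add: heat_def flip: scaleR_scaleR)
qed

end

section \<open>Fourier inversion and the difference between \<open>f\<close> and
  \<open>heat r f\<close>\<close>

lemma heat_tendsto:
  fixes f :: "'a::euclidean_space \<Rightarrow> complex"
  assumes f: "continuous_on UNIV f" and B: "\<And>x. norm (f x) \<le> B" and r: "r \<longlonglongrightarrow> 0"
  shows "(\<lambda>n. heat (r n) f x) \<longlonglongrightarrow> f x"
proof -
  have [measurable]: "f \<in> borel_measurable borel"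
    using f by (rule borel_measurable_continuous_onI)
  have "(\<lambda>n. LINT z|lborel. gauss z *\<^sub>R f (x + r n *\<^sub>R z)) \<longlonglongrightarrow> (LINT z|(lborel :: 'a measure). gauss z *\<^sub>R f x)"
  proof (rule integral_dominated_convergence[where w = "\<lambda>z::'a. gauss z * B"])
    have "(\<lambda>n. f (x + r n *\<^sub>R z)) \<longlonglongrightarrow> f x" for z
    proof -
      have "(\<lambda>n. x + r n *\<^sub>R z) \<longlonglongrightarrow> x + 0 *\<^sub>R z"
        by (intro tendsto_intros r)
      then show ?thesis
        using f by (auto simp: continuous_on_eq_continuous_at intro: isCont_tendsto_compose)
    qed
    then show "AE z in lborel. (\<lambda>n. gauss z *\<^sub>R f (x + r n *\<^sub>R z)) \<longlonglongrightarrow> gauss z *\<^sub>R f x"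
      by (intro AE_I2 tendsto_intros)
    show "AE z in lborel. norm (gauss z *\<^sub>R f (x + r n *\<^sub>R z)) \<le> gauss z * B" for n
      by (intro AE_I2) (auto intro!: mult_left_mono B)
  qed (auto simp: integrable_gauss)
  then show ?thesis
    by (simp add: heat_def integrable_gauss integral_gauss)
qed

text \<open>Let r tend to 0 in \<open>heat_inversion\<close>: the left side converges by dominated
  convergence with the norm of \<open>ft f\<close> as dominating function, the right side by
  \<open>heat_tendsto\<close>.\<close>

theorem ft_inversion:
  fixes f :: "'a::euclidean_space \<Rightarrow> complex"
  assumes f: "integrable lborel f" "continuous_on UNIV f" and B: "\<And>x. norm (f x) \<le> B"
    and ft: "integrable lborel (ft f)"
  shows "(LINT \<xi>|lborel. cis (x \<bullet> \<xi>) * ft f \<xi>) = (2 * pi) ^ DIM('a) *\<^sub>R f x"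
proof -
  define r :: "nat \<Rightarrow> real" where "r n = inverse (real (Suc n))" for n
  have r: "r \<longlonglongrightarrow> 0" "\<And>n. r n \<noteq> 0"
    unfolding r_def by (rule LIMSEQ_inverse_real_of_nat) simp
  have [measurable]: "ft f \<in> borel_measurable borel"
    using borel_measurable_integrable[OF ft] by simp
  have "(\<lambda>n. LINT \<xi>|lborel. cis (x \<bullet> \<xi>) * (exp (- (r n)\<^sup>2 * (norm \<xi>)\<^sup>2 / 2) *\<^sub>R ft f \<xi>))
      \<longlonglongrightarrow> (LINT \<xi>|lborel. cis (x \<bullet> \<xi>) * ft f \<xi>)"
  proof (rule integral_dominated_convergence[where w = "\<lambda>\<xi>. norm (ft f \<xi>)"])
    have "(\<lambda>n. cis (x \<bullet> \<xi>) * (exp (- (r n)\<^sup>2 * (norm \<xi>)\<^sup>2 / 2) *\<^sub>R ft f \<xi>))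
        \<longlonglongrightarrow> cis (x \<bullet> \<xi>) * (exp (- 0\<^sup>2 * (norm \<xi>)\<^sup>2 / 2) *\<^sub>R ft f \<xi>)" for \<xi>
      by (intro tendsto_intros r) auto
    then show "AE \<xi> in lborel. (\<lambda>n. cis (x \<bullet> \<xi>) * (exp (- (r n)\<^sup>2 * (norm \<xi>)\<^sup>2 / 2) *\<^sub>R ft f \<xi>))
        \<longlonglongrightarrow> cis (x \<bullet> \<xi>) * ft f \<xi>"
      by simp
    show "AE \<xi> in lborel. norm (cis (x \<bullet> \<xi>) * (exp (- (r n)\<^sup>2 * (norm \<xi>)\<^sup>2 / 2) *\<^sub>R ft f \<xi>)) \<le> norm (ft f \<xi>)" for n
      by (intro AE_I2) (auto simp: norm_mult intro!: mult_left_le_one_le)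
  qed (use ft in auto)
  moreover have "(\<lambda>n. LINT \<xi>|lborel. cis (x \<bullet> \<xi>) * (exp (- (r n)\<^sup>2 * (norm \<xi>)\<^sup>2 / 2) *\<^sub>R ft f \<xi>))
      \<longlonglongrightarrow> (2 * pi) ^ DIM('a) *\<^sub>R f x"
    unfolding heat_inversion[OF f(1) r(2)]
    by (intro tendsto_intros heat_tendsto[OF f(2) B r(1)])
  ultimately show ?thesis
    by (rule LIMSEQ_unique)
qed

text \<open>The difference of \<open>ft_inversion\<close> and \<open>heat_inversion\<close>; r = 0,
  which the latter excludes, follows from \<open>heat_0\<close>.\<close>

lemma heat_difference:
  fixes f :: "'a::euclidean_space \<Rightarrow> complex"
  assumes f: "integrable lborel f" "continuous_on UNIV f" and B: "\<And>x. norm (f x) \<le> B"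
    and ft: "integrable lborel (ft f)"
  shows "(LINT \<xi>|lborel. cis (x \<bullet> \<xi>) * ((1 - exp (- r\<^sup>2 * (norm \<xi>)\<^sup>2 / 2)) *\<^sub>R ft f \<xi>)) =
    (2 * pi) ^ DIM('a) *\<^sub>R (f x - heat r f x)"
proof (cases "r = 0")
  case False
  have [measurable]: "ft f \<in> borel_measurable borel"
    using borel_measurable_integrable[OF ft] by simp
  have "integrable lborel (\<lambda>\<xi>. cis (x \<bullet> \<xi>) * (exp (- r\<^sup>2 * (norm \<xi>)\<^sup>2 / 2) *\<^sub>R ft f \<xi>))"
    by (rule Bochner_Integration.integrable_bound[OF ft])
      (auto simp: norm_mult intro!: mult_left_le_one_le)
  then have "(LINT \<xi>|lborel. cis (x \<bullet> \<xi>) * ft f \<xi> - cis (x \<bullet> \<xi>) * (exp (- r\<^sup>2 * (norm \<xi>)\<^sup>2 / 2) *\<^sub>R ft f \<xi>)) =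
    (2 * pi) ^ DIM('a) *\<^sub>R f x - (2 * pi) ^ DIM('a) *\<^sub>R heat r f x"
    using integrable_cis_mult[OF ft, of "\<lambda>\<xi>. x \<bullet> \<xi>"]
    by (simp only: Bochner_Integration.integral_diff ft_inversion[OF f B ft]
        heat_inversion[OF f(1) False] borel_measurable_inner measurable_lborel2
        borel_measurable_const measurable_ident_sets[OF refl])
  then show ?thesis
    by (simp add: algebra_simps scaleR_left_diff_distrib)
qed (simp add: heat_0)

text \<open>An antiderivative of u exp(-u^2 c/2) c is -exp(-u^2 c/2). Keeping \<open>c\<close> as a
  factor instead of dividing by it covers c = 0, which occurs at \<xi> = 0.\<close>

lemma integral_times_exp:
  fixes c :: real
  shows "(LINT u|lborel. indicator {0..1} u * (u * exp (- u\<^sup>2 * c / 2))) * c = 1 - exp (- c / 2)"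
proof -
  have "((\<lambda>u. u * exp (- u\<^sup>2 * c / 2) * c) has_integral
      (- exp (- 1\<^sup>2 * c / 2)) - (- exp (- 0\<^sup>2 * c / 2))) {0..1::real}"
    by (intro fundamental_theorem_of_calculus)
      (auto simp flip: has_real_derivative_iff_has_vector_derivative
        intro!: derivative_eq_intros)
  moreover have "set_integrable lborel {0..1} (\<lambda>u. u * exp (- u\<^sup>2 * c / 2) * c)"
    by (intro borel_integrable_atLeastAtMost' continuous_intros) auto
  ultimately have "(LINT u:{0..1}|lborel. u * exp (- u\<^sup>2 * c / 2) * c) =
      (- exp (- 1\<^sup>2 * c / 2)) - (- exp (- 0\<^sup>2 * c / 2))"
    by (simp only: set_borel_integral_eq_integral(2) integral_unique)
  then show ?thesis
    by (simp add: set_lebesgue_integral_def mult.assoc flip: integral_mult_left_zero)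
qed

text \<open>Here \<open>g\<close> stands for minus the Laplacian of \<open>f\<close>, given only
  through its transform. On the Fourier side this is \<open>integral_times_exp\<close> with c = r^2
  |\<xi>|^2, whose factor |\<xi>|^2 turns \<open>ft f\<close> into \<open>ft g\<close>;
  \<open>heat_inversion\<close> for \<open>g\<close> carries it back.\<close>

lemma heat_difference_eq:
  fixes f g :: "'a::euclidean_space \<Rightarrow> complex"
  assumes f: "integrable lborel f" "continuous_on UNIV f" and B: "\<And>x. norm (f x) \<le> B"
    and ft: "integrable lborel (ft f)"
    and g: "integrable lborel g" and ft_g: "\<And>\<xi>. ft g \<xi> = (norm \<xi>)\<^sup>2 *\<^sub>R ft f \<xi>"
    and int_g: "integrable lborel (ft g)" and "r \<noteq> 0"
  shows "f x - heat r f x = r\<^sup>2 *\<^sub>R (LINT u|lborel. (indicator {0..1} u * u) *\<^sub>R heat (u * r) g x)"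
proof -
  \<comment> \<open>The indicator is idempotent, so it is written twice: once to bound the kernel,
    once to supply an integrable function of \<open>u\<close>.\<close>
  let ?F = "\<lambda>u \<xi>. ((u * indicator {0..1} u * exp (- u\<^sup>2 * (r\<^sup>2 * (norm \<xi>)\<^sup>2) / 2)) *\<^sub>R cis (x \<bullet> \<xi>)) *
    (complex_of_real (indicator {0..1} u) * ft g \<xi>)"
  have [measurable]: "g \<in> borel_measurable borel"
    using borel_measurable_integrable[OF g] by simp
  have i1: "integrable lborel (\<lambda>u::real. complex_of_real (indicator {0..1} u))"
    by (intro integrable_of_real) simp
  have Fub: "(LINT u|lborel. LINT \<xi>|lborel. ?F u \<xi>) = (LINT \<xi>|lborel. LINT u|lborel. ?F u \<xi>)"
    by (rule Fubini_bounded_kernel[OF i1 int_g, where B = 1])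
      (measurable, auto simp: indicator_def intro!: mult_le_one)
  have "(2 * pi) ^ DIM('a) *\<^sub>R (f x - heat r f x) =
      (LINT \<xi>|lborel. cis (x \<bullet> \<xi>) * ((1 - exp (- r\<^sup>2 * (norm \<xi>)\<^sup>2 / 2)) *\<^sub>R ft f \<xi>))"
    using heat_difference[OF f B ft] by simp
  also have "\<dots> = (LINT \<xi>|lborel. r\<^sup>2 *\<^sub>R (LINT u|lborel. ?F u \<xi>))"
  proof (intro Bochner_Integration.integral_cong refl)
    fix \<xi> :: 'a
    let ?c = "r\<^sup>2 * (norm \<xi>)\<^sup>2"
    have "?F u \<xi> = of_real (indicator {0..1} u * (u * exp (- u\<^sup>2 * ?c / 2))) * (cis (x \<bullet> \<xi>) * ft g \<xi>)" for u
      by (simp add: indicator_def scaleR_conv_of_real)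
    then have "r\<^sup>2 *\<^sub>R (LINT u|lborel. ?F u \<xi>) =
        r\<^sup>2 *\<^sub>R (of_real (LINT u|lborel. indicator {0..1} u * (u * exp (- u\<^sup>2 * ?c / 2))) * (cis (x \<bullet> \<xi>) * ft g \<xi>))"
      by (simp only: integral_mult_left_zero integral_complex_of_real)
    also have "\<dots> = of_real ((LINT u|lborel. indicator {0..1} u * (u * exp (- u\<^sup>2 * ?c / 2))) * ?c) * (cis (x \<bullet> \<xi>) * ft f \<xi>)"
      by (simp add: ft_g scaleR_conv_of_real)
    finally show "cis (x \<bullet> \<xi>) * ((1 - exp (- r\<^sup>2 * (norm \<xi>)\<^sup>2 / 2)) *\<^sub>R ft f \<xi>) = r\<^sup>2 *\<^sub>R (LINT u|lborel. ?F u \<xi>)"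
      unfolding integral_times_exp by (simp add: scaleR_conv_of_real)
  qed
  also have "\<dots> = r\<^sup>2 *\<^sub>R (LINT u|lborel. LINT \<xi>|lborel. ?F u \<xi>)"
    unfolding Fub by simp
  also have "(LINT u|lborel. LINT \<xi>|lborel. ?F u \<xi>) =
      (LINT u|lborel. (2 * pi) ^ DIM('a) *\<^sub>R ((indicator {0..1} u * u) *\<^sub>R heat (u * r) g x))"
  \<comment> \<open>Equality only almost everywhere, since \<open>heat_inversion\<close> does not
    apply at u = 0.\<close>
  proof (rule Bochner_Integration.integral_cong_AE)
    have "AE u in lborel. u \<noteq> (0::real)"
      by (rule AE_lborel_singleton)
    then show "AE u in lborel. (LINT \<xi>|lborel. ?F u \<xi>) =
        (2 * pi) ^ DIM('a) *\<^sub>R ((indicator {0..1} u * u) *\<^sub>R heat (u * r) g x)"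
    proof eventually_elim
      case (elim u)
      have "?F u \<xi> = (indicator {0..1} u * u) *\<^sub>R
          (cis (x \<bullet> \<xi>) * (exp (- (u * r)\<^sup>2 * (norm \<xi>)\<^sup>2 / 2) *\<^sub>R ft g \<xi>))" for \<xi>
        by (simp add: indicator_def scaleR_conv_of_real power_mult_distrib mult.assoc)
      then have "(LINT \<xi>|lborel. ?F u \<xi>) = (indicator {0..1} u * u) *\<^sub>R
          (LINT \<xi>|lborel. cis (x \<bullet> \<xi>) * (exp (- (u * r)\<^sup>2 * (norm \<xi>)\<^sup>2 / 2) *\<^sub>R ft g \<xi>))"
        by (simp only: integral_scaleR_right)
      then show ?case
        using heat_inversion[OF g, of "u * r" x] elim \<open>r \<noteq> 0\<close> by simp
    qed
  qed measurable
  finally have "(2 * pi) ^ DIM('a) *\<^sub>R (f x - heat r f x) = (2 * pi) ^ DIM('a) *\<^sub>R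
      (r\<^sup>2 *\<^sub>R (LINT u|lborel. (indicator {0..1} u * u) *\<^sub>R heat (u * r) g x))"
    by (simp only: integral_scaleR_right scaleR_left_commute[of "r\<^sup>2"])
  then show ?thesis
    by (simp only: scaleR_cancel_left) simp
qed

text \<open>The norm goes inside the formula of \<open>heat_difference_eq\<close>; each
  \<open>heat (u * r) g\<close> has L1 norm at most that of \<open>g\<close>, and the weight
  \<open>u\<close> is at most 1 on the unit interval.\<close>

lemma heat_difference_norm_le:
  fixes f g :: "'a::euclidean_space \<Rightarrow> complex"
  assumes f: "integrable lborel f" "continuous_on UNIV f" and B: "\<And>x. norm (f x) \<le> B"
    and ft: "integrable lborel (ft f)"
    and g: "integrable lborel g" and ft_g: "\<And>\<xi>. ft g \<xi> = (norm \<xi>)\<^sup>2 *\<^sub>R ft f \<xi>"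
    and int_g: "integrable lborel (ft g)" and "r \<noteq> 0"
  shows "(LINT x|lborel. norm (f x - heat r f x)) \<le> r\<^sup>2 * (LINT x|lborel. norm (g x))"
proof -
  let ?F = "\<lambda>u x. (indicator {0..1} u * u) *\<^sub>R heat (u * r) g x"
  let ?I = "LINT x|lborel. norm (g x)"
  have [measurable]: "g \<in> borel_measurable borel" "f \<in> borel_measurable borel"
    using borel_measurable_integrable[OF g] borel_measurable_integrable[OF f(1)] by simp_all
  have le: "(LINT x|lborel. norm (?F u x)) \<le> indicator {0..1} u * ?I" for u
    using mult_mono[of "\<bar>indicator {0..1} u * u\<bar>" "indicator {0..1} u", OF _ integral_norm_heat_le[OF g, of "u * r"]]
    by (auto simp: indicator_def)
  have int: "integrable (lborel \<Otimes>\<^sub>M lborel) (\<lambda>(u, x). ?F u x)"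
  proof (rule lborel_pair.Fubini_integrable)
    have "integrable lborel (\<lambda>u. LINT x|lborel. norm (?F u x))"
    proof (rule Bochner_Integration.integrable_bound)
      show "integrable lborel (\<lambda>u::real. indicator {0..1} u * ?I)"
        by simp
      show "AE u in lborel. norm (LINT x|lborel. norm (?F u x)) \<le> norm (indicator {0..1} u * ?I)"
        using le order_trans[OF le abs_ge_self] by (intro AE_I2) (auto simp: integral_nonneg)
    qed measurable
    then show "integrable lborel (\<lambda>u. LINT x|lborel. norm (case (u, x) of (u, x) \<Rightarrow> ?F u x))"
      by simp
  qed (auto simp: integrable_heat[OF g])
  have int_norm: "integrable (lborel \<Otimes>\<^sub>M lborel) (\<lambda>(u, x). norm (?F u x))"
    using integrable_norm[OF int] by (simp add: case_prod_beta')
  have "(LINT x|lborel. norm (f x - heat r f x)) = r\<^sup>2 * (LINT x|lborel. norm (LINT u|lborel. ?F u x))"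
    unfolding heat_difference_eq[OF assms] by simp
  also have "(LINT x|lborel. norm (LINT u|lborel. ?F u x)) \<le> (LINT x|lborel. LINT u|lborel. norm (?F u x))"
    by (intro integral_mono integral_norm_bound lborel_pair.integrable_snd[OF int_norm]
        integrable_norm lborel_pair.integrable_snd[OF int])
  also have "(LINT x|lborel. LINT u|lborel. norm (?F u x)) = (LINT u|lborel. LINT x|lborel. norm (?F u x))"
    by (rule lborel_pair.Fubini_integral[OF int_norm])
  also have "\<dots> \<le> (LINT u|lborel. indicator {0..1} (u::real) * ?I)"
    by (intro integral_mono le lborel_pair.integrable_fst[OF int_norm]) auto
  also have "\<dots> = ?I"
    by simp
  finally show ?thesis
    by (simp add: mult_left_mono)
qed

section \<open>The square root of the Laplacian on integrable functions\<close>

lemma integrable_inverse_1_plus_power2: "integrable lborel (\<lambda>r::real. 1 / (1 + r\<^sup>2))"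
  using integrable_inverse_1_plus_square
  by (simp add: set_integrable_def inverse_eq_divide)

text \<open>At r = 0 division by zero gives 0 rather than the limit a^2/2; a single point does not
  affect the integral.\<close>

definition sqrt_kernel :: "real \<Rightarrow> real \<Rightarrow> real" where
  "sqrt_kernel a r = (1 - exp (- r\<^sup>2 * a\<^sup>2 / 2)) / r\<^sup>2"

lemma sqrt_kernel_nonneg: "sqrt_kernel a r \<ge> 0"
  by (simp add: sqrt_kernel_def)

text \<open>Two bounds on 1 - exp(-t) are added: by t, which controls small r, and by 1, which
  controls large r. The result separates \<open>a\<close> from \<open>r\<close>, as the later use of
  Fubini requires.\<close>

lemma sqrt_kernel_le: "sqrt_kernel a r \<le> (1 + a\<^sup>2) / (1 + r\<^sup>2)"
proof (cases "r = 0")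
  case False
  have "(1 - exp (- r\<^sup>2 * a\<^sup>2 / 2)) * (1 + r\<^sup>2) = (1 - exp (- r\<^sup>2 * a\<^sup>2 / 2)) + (1 - exp (- r\<^sup>2 * a\<^sup>2 / 2)) * r\<^sup>2"
    by (simp add: algebra_simps)
  also have "\<dots> \<le> r\<^sup>2 * a\<^sup>2 + 1 * r\<^sup>2"
  proof (intro add_mono mult_right_mono)
    have "r\<^sup>2 * a\<^sup>2 \<ge> 0"
      by simp
    then show "1 - exp (- r\<^sup>2 * a\<^sup>2 / 2) \<le> r\<^sup>2 * a\<^sup>2"
      using exp_ge_add_one_self[of "- r\<^sup>2 * a\<^sup>2 / 2"] by linarith
  qed auto
  also have "\<dots> = r\<^sup>2 * (1 + a\<^sup>2)"
    by (simp add: algebra_simps)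
  finally show ?thesis
    using False by (simp add: sqrt_kernel_def divide_le_eq pos_le_divide_eq add_pos_nonneg mult.commute)
qed (simp add: sqrt_kernel_def)

lemma measurable_sqrt_kernel [measurable]:
  "(\<lambda>(a, r). sqrt_kernel a r) \<in> borel_measurable (borel \<Otimes>\<^sub>M borel)"
  unfolding sqrt_kernel_def by measurable

lemma integrable_sqrt_kernel: "integrable lborel (sqrt_kernel a)"
proof (rule Bochner_Integration.integrable_bound)
  show "integrable lborel (\<lambda>r. (1 + a\<^sup>2) * (1 / (1 + r\<^sup>2)))"
    by (intro integrable_mult_right integrable_inverse_1_plus_power2)
  show "AE r in lborel. norm (sqrt_kernel a r) \<le> norm ((1 + a\<^sup>2) * (1 / (1 + r\<^sup>2)))"
    using sqrt_kernel_le sqrt_kernel_nonneg by (intro AE_I2) (simp add: add_pos_nonneg)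
qed measurable

text \<open>\<open>sqrt_kernel \<bar>a\<bar> r\<close> is a^2 times \<open>sqrt_kernel 1\<close> at
  a r, and the substitution costs one factor |a|. This homogeneity is what produces |\<xi>| from
  Gaussians.\<close>

lemma integral_sqrt_kernel: "(LINT r|lborel. sqrt_kernel \<bar>a\<bar> r) = \<bar>a\<bar> * (LINT r|lborel. sqrt_kernel 1 r)"
proof (cases "a = 0")
  case False
  have "\<bar>a\<bar> * (LINT r|lborel. sqrt_kernel 1 r) = a\<^sup>2 * (LINT r|lborel. sqrt_kernel 1 (0 + a * r))"
    using lborel_integral_real_affine[OF False, of "sqrt_kernel 1" 0]
    by (simp only: real_scaleR_def mult.assoc[symmetric]) (simp add: power2_eq_square)
  also have "\<dots> = (LINT r|lborel. a\<^sup>2 * sqrt_kernel 1 (0 + a * r))"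
    by (rule integral_mult_right_zero[symmetric])
  also have "(\<lambda>r. a\<^sup>2 * sqrt_kernel 1 (0 + a * r)) = sqrt_kernel \<bar>a\<bar>"
  proof
    show "a\<^sup>2 * sqrt_kernel 1 (0 + a * r) = sqrt_kernel \<bar>a\<bar> r" for r
      using False unfolding sqrt_kernel_def power2_abs power_mult_distrib
      by (simp add: power_mult_distrib mult.commute)
  qed
  finally show ?thesis
    by simp
qed (simp add: sqrt_kernel_def)

text \<open>The kernel is nonnegative and vanishes only at r = 0. Positivity allows division by this
  constant.\<close>

lemma integral_sqrt_kernel_pos: "(LINT r|lborel. sqrt_kernel 1 r) > 0"
proof -
  have "(LINT r|lborel. sqrt_kernel 1 r) \<noteq> 0"
  proof
    assume "(LINT r|lborel. sqrt_kernel 1 r) = 0"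
    then have "AE r in lborel. sqrt_kernel 1 r = 0"
      by (subst (asm) integral_nonneg_eq_0_iff_AE[OF integrable_sqrt_kernel])
        (auto simp: sqrt_kernel_nonneg)
    then have "AE r::real in lborel. r = 0"
      by eventually_elim (auto simp: sqrt_kernel_def)
    moreover have "AE r::real in lborel. r \<noteq> 0"
      by (rule AE_lborel_singleton)
    ultimately have "AE r::real in lborel. False"
      by eventually_elim simp
    then show False
      by (simp add: eventually_False ae_filter_eq_bot_iff)
  qed
  then show ?thesis
    using Bochner_Integration.integral_nonneg[of lborel "sqrt_kernel 1", OF sqrt_kernel_nonneg]
    by linarith
qed

text \<open>The role of minus the Laplacian of \<open>f\<close> is taken by \<open>g\<close>, tied
  to \<open>f\<close> by \<open>ft_g\<close> alone, so no derivatives occur. \<open>h\<close> is the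
  half Laplacian up to a power of 2 pi.\<close>

theorem
  fixes f g :: "'a::euclidean_space \<Rightarrow> complex"
  assumes f: "integrable lborel f" "continuous_on UNIV f" and B: "\<And>x. norm (f x) \<le> B"
    and ft: "integrable lborel (ft f)"
    and g: "integrable lborel g" and ft_g: "\<And>\<xi>. ft g \<xi> = (norm \<xi>)\<^sup>2 *\<^sub>R ft f \<xi>"
    and int_g: "integrable lborel (ft g)"
  defines "h \<equiv> \<lambda>x. LINT \<xi>|lborel. cis (x \<bullet> \<xi>) * (norm \<xi> *\<^sub>R ft f \<xi>)"
  shows integrable_half_laplacian: "integrable lborel h"
    and ft_half_laplacian: "ft h k = (2 * pi) ^ DIM('a) *\<^sub>R (norm k *\<^sub>R ft f k)"
proof -
  let ?C = "LINT r|lborel. sqrt_kernel 1 r"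
  let ?D = "\<lambda>r x. (f x - heat r f x) /\<^sub>R r\<^sup>2"
  let ?If = "LINT x|lborel. norm (f x)" and ?Ig = "LINT x|lborel. norm (g x)"
  have [measurable]: "g \<in> borel_measurable borel" "f \<in> borel_measurable borel"
    using borel_measurable_integrable[OF g] borel_measurable_integrable[OF f(1)] by simp_all
  have C: "?C > 0"
    by (rule integral_sqrt_kernel_pos)
  have int_w: "integrable lborel (\<lambda>\<xi>. (1 + (norm \<xi>)\<^sup>2) *\<^sub>R ft f \<xi>)"
    using Bochner_Integration.integrable_add[OF ft int_g] by (simp add: ft_g scaleR_left_distrib)
  have h_eq: "?C *\<^sub>R h x = (2 * pi) ^ DIM('a) *\<^sub>R (LINT r|lborel. ?D r x)" for x
  proof -
    \<comment> \<open>\<open>?w\<close> is the reciprocal of the bound in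
      \<open>sqrt_kernel_le\<close>, so kernel times \<open>?w\<close> is at most 1. The
      compensating weights go to the other factors: 1/(1+r^2) is integrable in \<open>r\<close>, and
      (1+|\<xi>|^2) times \<open>ft f\<close> is \<open>ft f\<close> plus
      \<open>ft g\<close>.\<close>
    let ?w = "\<lambda>r \<xi>::'a. (1 + r\<^sup>2) / (1 + (norm \<xi>)\<^sup>2)"
    let ?F = "\<lambda>r \<xi>. ((sqrt_kernel (norm \<xi>) r * ?w r \<xi>) *\<^sub>R cis (x \<bullet> \<xi>)) *
      (complex_of_real (1 / (1 + r\<^sup>2)) * ((1 + (norm \<xi>)\<^sup>2) *\<^sub>R ft f \<xi>))"
    have pos: "1 + t\<^sup>2 > 0" for t :: real
      by (simp add: add_pos_nonneg)
    have F_eq: "?F r \<xi> = sqrt_kernel (norm \<xi>) r *\<^sub>R (cis (x \<bullet> \<xi>) * ft f \<xi>)" for r \<xi>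
    proof -
      have "((s * (p / q)) *\<^sub>R c) * (of_real (1 / p) * (q *\<^sub>R t)) = s *\<^sub>R (c * t)"
        if "p > 0" "q > 0" for p q s and c t :: complex
        using that by (simp add: scaleR_conv_of_real)
      from this[OF pos pos] show ?thesis .
    qed
    have Fub: "(LINT r|lborel. LINT \<xi>|lborel. ?F r \<xi>) = (LINT \<xi>|lborel. LINT r|lborel. ?F r \<xi>)"
    proof (rule Fubini_bounded_kernel[OF integrable_of_real[OF integrable_inverse_1_plus_power2] int_w])
      show "norm ((sqrt_kernel (norm \<xi>) r * ?w r \<xi>) *\<^sub>R cis (x \<bullet> \<xi>)) \<le> 1" for r and \<xi> :: 'a
        using sqrt_kernel_le[of "norm \<xi>" r] sqrt_kernel_nonneg[of "norm \<xi>" r] pos[of r] pos[of "norm \<xi>"]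
        by (simp add: abs_mult field_simps)
    qed measurable
    have "?C *\<^sub>R h x = (LINT \<xi>|lborel. (LINT r|lborel. sqrt_kernel (norm \<xi>) r) *\<^sub>R (cis (x \<bullet> \<xi>) * ft f \<xi>))"
      unfolding h_def integral_scaleR_right[symmetric]
    proof (intro Bochner_Integration.integral_cong refl)
      show "?C *\<^sub>R (cis (x \<bullet> \<xi>) * (norm \<xi> *\<^sub>R ft f \<xi>)) =
          (LINT r|lborel. sqrt_kernel (norm \<xi>) r) *\<^sub>R (cis (x \<bullet> \<xi>) * ft f \<xi>)" for \<xi>
        using integral_sqrt_kernel[of "norm \<xi>"] by (simp add: mult.commute)
    qed
    also have "\<dots> = (LINT \<xi>|lborel. LINT r|lborel. ?F r \<xi>)"
      unfolding F_eq by (intro Bochner_Integration.integral_cong refl) (simp add: integrable_sqrt_kernel)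
    also have "\<dots> = (LINT r|lborel. LINT \<xi>|lborel. ?F r \<xi>)"
      using Fub by simp
    also have "\<dots> = (LINT r|lborel. (2 * pi) ^ DIM('a) *\<^sub>R ?D r x)"
    proof (intro Bochner_Integration.integral_cong refl)
      fix r
      have "(LINT \<xi>|lborel. ?F r \<xi>) =
          (LINT \<xi>|lborel. inverse (r\<^sup>2) *\<^sub>R (cis (x \<bullet> \<xi>) * ((1 - exp (- r\<^sup>2 * (norm \<xi>)\<^sup>2 / 2)) *\<^sub>R ft f \<xi>)))"
        unfolding F_eq
        unfolding sqrt_kernel_def divide_inverse_commute[of _ "r\<^sup>2"]
          scaleR_scaleR[symmetric] mult_scaleR_right ..
      also have "\<dots> = inverse (r\<^sup>2) *\<^sub>R ((2 * pi) ^ DIM('a) *\<^sub>R (f x - heat r f x))"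
        unfolding integral_scaleR_right heat_difference[OF f B ft] ..
      finally show "(LINT \<xi>|lborel. ?F r \<xi>) = (2 * pi) ^ DIM('a) *\<^sub>R ?D r x"
        by (simp only: scaleR_left_commute)
    qed
    finally show ?thesis
      by (simp only: integral_scaleR_right)
  qed
  \<comment> \<open>For r nonzero, contraction bounds \<open>?N\<close> by \<open>2 * ?If\<close>,
    and \<open>heat_difference_norm_le\<close> bounds it by r^2 times \<open>?Ig\<close>. Adding r^2
    times the first bound to the second gives the decay 1/(1+r^2). At r = 0 division by zero makes
    \<open>?D\<close> vanish.\<close>
  have le: "(LINT x|lborel. norm (?D r x)) \<le> (2 * ?If + ?Ig) * (1 / (1 + r\<^sup>2))" for r
  proof (cases "r = 0")
    case False
    let ?N = "LINT x|lborel. norm (f x - heat r f x)"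
    have "?N \<le> (LINT x|lborel. norm (f x) + norm (heat r f x))"
      by (intro integral_mono integrable_norm Bochner_Integration.integrable_diff
          Bochner_Integration.integrable_add f integrable_heat norm_triangle_ineq4)
    also have "\<dots> \<le> 2 * ?If"
      using integral_norm_heat_le[OF f(1), of r] f integrable_heat[OF f(1), of r] by simp
    finally have "r\<^sup>2 * ?N \<le> r\<^sup>2 * (2 * ?If)"
      by (intro mult_left_mono) auto
    moreover have "?N \<le> r\<^sup>2 * ?Ig"
      by (rule heat_difference_norm_le[OF f B ft g ft_g int_g False])
    ultimately have "?N * (1 + r\<^sup>2) \<le> r\<^sup>2 * (2 * ?If + ?Ig)"
      by (simp add: algebra_simps)
    moreover have "a / p \<le> c * (1 / q)" if "a * q \<le> p * c" "p > 0" "q > 0" for a c p q :: real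
      using that by (simp add: divide_simps mult.commute)
    moreover have "r\<^sup>2 > 0" "1 + r\<^sup>2 > 0"
      using False by (auto simp: add_pos_nonneg)
    ultimately have "?N / r\<^sup>2 \<le> (2 * ?If + ?Ig) * (1 / (1 + r\<^sup>2))"
      by blast
    moreover have "(LINT x|lborel. norm (?D r x)) = ?N / r\<^sup>2"
      by (simp add: divide_inverse_commute)
    ultimately show ?thesis
      by (simp only:)
  qed (simp add: integral_nonneg)
  have int: "integrable (lborel \<Otimes>\<^sub>M lborel) (\<lambda>(r, x). ?D r x)"
  proof (rule lborel_pair.Fubini_integrable)
    have "integrable lborel (\<lambda>r. LINT x|lborel. norm (?D r x))"
    proof (rule Bochner_Integration.integrable_bound)
      show "integrable lborel (\<lambda>r. (2 * ?If + ?Ig) * (1 / (1 + r\<^sup>2)))"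
        by (intro integrable_mult_right integrable_inverse_1_plus_power2)
      show "AE r in lborel. norm (LINT x|lborel. norm (?D r x)) \<le> norm ((2 * ?If + ?Ig) * (1 / (1 + r\<^sup>2)))"
        using order_trans[OF le abs_ge_self] by (intro AE_I2) (simp add: integral_nonneg)
    qed measurable
    then show "integrable lborel (\<lambda>r. LINT x|lborel. norm (case (r, x) of (r, x) \<Rightarrow> ?D r x))"
      by simp
  qed (auto simp: f integrable_heat)
  have h: "h = (\<lambda>x. ((2 * pi) ^ DIM('a) / ?C) *\<^sub>R (LINT r|lborel. ?D r x))"
  proof
    fix x
    have "h x = (?C *\<^sub>R h x) /\<^sub>R ?C"
      using C by simp
    then show "h x = ((2 * pi) ^ DIM('a) / ?C) *\<^sub>R (LINT r|lborel. ?D r x)"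
      unfolding h_eq scaleR_scaleR divide_inverse_commute .
  qed
  show "integrable lborel h"
    unfolding h by (intro integrable_scaleR_right lborel_pair.integrable_snd[OF int])
  \<comment> \<open>Characters have norm 1, so \<open>?D\<close> dominates. Under the
    \<open>r\<close>-integral, \<open>ft_heat\<close> evaluates the pairing as
    \<open>sqrt_kernel (norm k) r\<close> times \<open>ft f k\<close>, and homogeneity of the kernel
    then cancels \<open>?C\<close>.\<close>
  let ?G = "\<lambda>r x. cis (- (x \<bullet> k)) * ?D r x"
  have intG: "integrable (lborel \<Otimes>\<^sub>M lborel) (\<lambda>(r, x). ?G r x)"
    by (rule Bochner_Integration.integrable_bound[OF int]) (auto simp: norm_mult)
  have "ft h k = ((2 * pi) ^ DIM('a) / ?C) *\<^sub>R (LINT x|lborel. LINT r|lborel. ?G r x)"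
    unfolding ft_def h mult_scaleR_right integral_scaleR_right integral_mult_right_zero[symmetric] ..
  also have "(LINT x|lborel. LINT r|lborel. ?G r x) = (LINT r|lborel. LINT x|lborel. ?G r x)"
    by (rule lborel_pair.Fubini_integral[OF intG])
  also have "\<dots> = (LINT r|lborel. sqrt_kernel (norm k) r *\<^sub>R ft f k)"
  proof (intro Bochner_Integration.integral_cong refl)
    fix r
    have "(LINT x|lborel. ?G r x) = (LINT x|lborel. cis (- (x \<bullet> k)) * f x - cis (- (x \<bullet> k)) * heat r f x) /\<^sub>R r\<^sup>2"
      unfolding mult_scaleR_right integral_scaleR_right right_diff_distrib ..
    also have "\<dots> = (ft f k - ft (heat r f) k) /\<^sub>R r\<^sup>2"
      unfolding ft_def
      by (subst Bochner_Integration.integral_diff) (auto intro!: integrable_cis_mult f integrable_heat)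
    also have "\<dots> = ((1 - exp (- r\<^sup>2 * (norm k)\<^sup>2 / 2)) *\<^sub>R ft f k) /\<^sub>R r\<^sup>2"
      unfolding ft_heat[OF f(1)] scaleR_left_diff_distrib by simp
    finally show "(LINT x|lborel. ?G r x) = sqrt_kernel (norm k) r *\<^sub>R ft f k"
      unfolding sqrt_kernel_def divide_inverse_commute scaleR_scaleR .
  qed
  also have "\<dots> = (norm k * ?C) *\<^sub>R ft f k"
    using integral_sqrt_kernel[of "norm k"]
    by (simp only: abs_norm_cancel integral_scaleR_left integrable_sqrt_kernel)
  also have "((2 * pi) ^ DIM('a) / ?C) *\<^sub>R ((norm k * ?C) *\<^sub>R ft f k) = (2 * pi) ^ DIM('a) *\<^sub>R (norm k *\<^sub>R ft f k)"
    using C by simp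
  finally show "ft h k = (2 * pi) ^ DIM('a) *\<^sub>R (norm k *\<^sub>R ft f k)" .
qed

section \<open>Schwartz functions\<close>

lemma partial_derivs_Nil [simp]: "partial_derivs [] f = f"
  by (simp add: partial_derivs_def)

lemma partial_derivs_Cons: "partial_derivs (j # js) f = partial_deriv j (partial_derivs js f)"
  by (simp add: partial_derivs_def)

lemma partial_derivs_append: "partial_derivs (is @ js) f = partial_derivs is (partial_derivs js f)"
  by (simp add: partial_derivs_def)

lemma partial_deriv_eq:
  "(f has_derivative D) (at x) \<Longrightarrow> partial_deriv j f x = D (axis j 1)"
  unfolding partial_deriv_def using frechet_derivative_at by metis

lemma partial_deriv_linear_comb:
  assumes "f differentiable (at x)" "g differentiable (at x)"
  shows "partial_deriv j (\<lambda>x. a * f x + b * g x) x = a * partial_deriv j f x + b * partial_deriv j g x"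
proof -
  have D: "(f has_derivative frechet_derivative f (at x)) (at x)"
    "(g has_derivative frechet_derivative g (at x)) (at x)"
    using assms by (simp_all add: frechet_derivative_works)
  show ?thesis
    by (subst partial_deriv_eq[OF has_derivative_add[OF has_derivative_mult_right[OF D(1)]
          has_derivative_mult_right[OF D(2)]]]) (simp add: partial_deriv_def)
qed

lemma partial_derivs_linear_comb:
  assumes "smooth f" "smooth g"
  shows "partial_derivs js (\<lambda>x. a * f x + b * g x) =
    (\<lambda>x. a * partial_derivs js f x + b * partial_derivs js g x)"
proof (induction js)
  case (Cons j js)
  then show ?case
    using assms by (auto simp: partial_derivs_Cons smooth_def partial_deriv_linear_comb)
qed simp

lemma schwartz_smooth: "f \<in> schwartz \<Longrightarrow> smooth f"
  by (simp add: schwartz_def)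

lemma schwartz_bdd: "f \<in> schwartz \<Longrightarrow> bdd_above (range (\<lambda>x. norm (monomial \<alpha> x *\<^sub>R partial_derivs js f x)))"
  by (simp add: schwartz_def)

lemma norm_monomial_le_seminorm:
  assumes "f \<in> schwartz"
  shows "\<bar>monomial \<alpha> x\<bar> * norm (partial_derivs js f x) \<le> schwartz_seminorm \<alpha> js f"
  unfolding schwartz_seminorm_def
  using cSUP_upper[OF UNIV_I schwartz_bdd[OF assms, of \<alpha> js], of x] by simp

lemma schwartz_linear_comb:
  assumes f: "f \<in> schwartz" and g: "g \<in> schwartz"
  shows "(\<lambda>x. a * f x + b * g x) \<in> schwartz"
proof -
  have "smooth (\<lambda>x. a * f x + b * g x)"
    using schwartz_smooth[OF f] schwartz_smooth[OF g]
    by (simp add: smooth_def partial_derivs_linear_comb[OF schwartz_smooth[OF f] schwartz_smooth[OF g]])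
  moreover have "bdd_above (range (\<lambda>x. norm (monomial \<alpha> x *\<^sub>R partial_derivs js (\<lambda>x. a * f x + b * g x) x)))"
    for \<alpha> js
  proof (rule bdd_aboveI2)
    fix x
    have "norm (monomial \<alpha> x *\<^sub>R partial_derivs js (\<lambda>x. a * f x + b * g x) x) \<le>
        \<bar>monomial \<alpha> x\<bar> * (norm a * norm (partial_derivs js f x) + norm b * norm (partial_derivs js g x))"
      unfolding partial_derivs_linear_comb[OF schwartz_smooth[OF f] schwartz_smooth[OF g]]
      by (simp add: mult_left_mono norm_triangle_mono norm_mult)
    also have "\<dots> = norm a * (\<bar>monomial \<alpha> x\<bar> * norm (partial_derivs js f x)) +
        norm b * (\<bar>monomial \<alpha> x\<bar> * norm (partial_derivs js g x))"
      by (simp add: algebra_simps)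
    also have "\<dots> \<le> norm a * schwartz_seminorm \<alpha> js f + norm b * schwartz_seminorm \<alpha> js g"
      by (intro add_mono mult_left_mono norm_monomial_le_seminorm f g) auto
    finally show "norm (monomial \<alpha> x *\<^sub>R partial_derivs js (\<lambda>x. a * f x + b * g x) x) \<le>
      norm a * schwartz_seminorm \<alpha> js f + norm b * schwartz_seminorm \<alpha> js g" .
  qed
  ultimately show ?thesis
    by (simp add: schwartz_def)
qed

lemma schwartz_add: "f \<in> schwartz \<Longrightarrow> g \<in> schwartz \<Longrightarrow> (\<lambda>x. f x + g x) \<in> schwartz"
  using schwartz_linear_comb[of f g 1 1] by simp

lemma schwartz_cmult: "f \<in> schwartz \<Longrightarrow> (\<lambda>x. a * f x) \<in> schwartz"
  using schwartz_linear_comb[of f f a 0] by simp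

lemma schwartz_diff: "f \<in> schwartz \<Longrightarrow> g \<in> schwartz \<Longrightarrow> (\<lambda>x. f x - g x) \<in> schwartz"
  using schwartz_linear_comb[of f g 1 "-1"] by simp

lemma schwartz_partial_deriv:
  assumes "f \<in> schwartz"
  shows "partial_deriv j f \<in> schwartz"
proof -
  have "partial_derivs js (partial_deriv j f) = partial_derivs (js @ [j]) f" for js
    by (simp add: partial_derivs_append partial_derivs_Cons)
  then show ?thesis
    using assms by (auto simp: schwartz_def smooth_def)
qed

lemma schwartz_differentiable: "f \<in> schwartz \<Longrightarrow> f differentiable (at x)"
  using schwartz_smooth[of f] by (metis smooth_def partial_derivs_Nil)

lemma schwartz_continuous: "f \<in> schwartz \<Longrightarrow> continuous_on S f"
  by (meson continuous_at_imp_continuous_on differentiable_imp_continuous_within schwartz_differentiable)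

section \<open>Decay and integrability of Schwartz functions\<close>

lemma prod_Basis_vec:
  fixes x :: "real^'n" and f :: "real \<Rightarrow> 'b::comm_monoid_mult"
  shows "(\<Prod>b\<in>Basis. f (x \<bullet> b)) = (\<Prod>i\<in>UNIV. f (x $ i))"
proof -
  have "(\<Prod>b\<in>Basis. f (x \<bullet> b)) = (\<Prod>b\<in>range (\<lambda>i. axis i 1). f (x \<bullet> b))"
    by (intro prod.cong refl) (auto simp: Basis_vec_def)
  also have "\<dots> = (\<Prod>i\<in>UNIV. f (x $ i))"
    by (subst prod.reindex) (auto simp: inj_def axis_eq_axis inner_axis)
  finally show ?thesis .
qed

lemma integrable_prod_inverse:
  "integrable lborel (\<lambda>x::real^'n. \<Prod>i\<in>UNIV. 1 / (1 + (x $ i)\<^sup>2))"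
  using lborel_integral_prod(1)[of "\<lambda>_::real^'n. \<lambda>t. 1 / (1 + t\<^sup>2)", OF integrable_inverse_1_plus_power2]
  unfolding prod_Basis_vec[of "\<lambda>t. 1 / (1 + t\<^sup>2)"] .

text \<open>Expanding the product of the 1 + x_i^2 over the subsets \<open>S\<close> of coordinates
  gives exactly these monomials. Hence this finite sum of Schwartz seminorms controls the L1
  norm.\<close>

definition l1_seminorm :: "(real^3 \<Rightarrow> complex) \<Rightarrow> real" where
  "l1_seminorm f = (\<Sum>S\<in>UNIV. schwartz_seminorm (\<lambda>i. if i \<in> S then 2 else 0) [] f)"

lemma norm_schwartz_le:
  assumes "f \<in> schwartz"
  shows "norm (f x) \<le> l1_seminorm f * (\<Prod>i\<in>UNIV. 1 / (1 + (x $ i)\<^sup>2))"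
proof -
  let ?P = "\<Prod>i\<in>UNIV. 1 + (x $ i)\<^sup>2"
  have m: "monomial (\<lambda>i. if i \<in> S then 2 else 0) x = (\<Prod>i\<in>S. (x $ i)\<^sup>2)" for S
    unfolding monomial_def
    by (subst prod.mono_neutral_cong_right[of UNIV S]) auto
  have "?P = (\<Sum>S\<in>UNIV. \<bar>monomial (\<lambda>i. if i \<in> S then 2 else 0) x\<bar>)"
    unfolding m by (subst add.commute, subst prod_add) (simp_all add: prod_nonneg)
  then have "?P * norm (f x) = (\<Sum>S\<in>UNIV. \<bar>monomial (\<lambda>i. if i \<in> S then 2 else 0) x\<bar> * norm (f x))"
    by (simp add: sum_distrib_right)
  also have "\<dots> \<le> l1_seminorm f"
    unfolding l1_seminorm_def
    using norm_monomial_le_seminorm[OF assms, of _ _ "[]"] by (intro sum_mono) simp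
  finally have "?P * norm (f x) \<le> l1_seminorm f" .
  moreover have "?P > 0"
    by (intro prod_pos) (simp add: add_pos_nonneg)
  ultimately have "norm (f x) \<le> l1_seminorm f / ?P"
    by (simp add: pos_le_divide_eq mult.commute)
  then show ?thesis
    by (simp add: prod_dividef)
qed

lemma schwartz_measurable: "f \<in> schwartz \<Longrightarrow> f \<in> borel_measurable borel"
  by (intro borel_measurable_continuous_onI schwartz_continuous)

lemma schwartz_integrable:
  assumes "f \<in> schwartz"
  shows "integrable lborel f"
proof (rule Bochner_Integration.integrable_bound)
  show "integrable lborel (\<lambda>x. l1_seminorm f * (\<Prod>i\<in>UNIV. 1 / (1 + (x $ i)\<^sup>2)))"
    by (intro integrable_mult_right integrable_prod_inverse)
  show "AE x in lborel. norm (f x) \<le> norm (l1_seminorm f * (\<Prod>i\<in>UNIV. 1 / (1 + (x $ i)\<^sup>2)))"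
    using order_trans[OF norm_schwartz_le[OF assms] abs_ge_self] by (intro AE_I2) simp
qed (simp add: schwartz_measurable assms)

lemma integral_norm_schwartz_le:
  assumes "f \<in> schwartz"
  shows "(LINT x|lborel. norm (f x)) \<le>
    l1_seminorm f * (LINT x|lborel. (\<Prod>i\<in>UNIV. 1 / (1 + ((x::real^3) $ i)\<^sup>2)))"
  unfolding integral_mult_right_zero[symmetric]
  by (intro integral_mono integrable_norm schwartz_integrable norm_schwartz_le assms
      integrable_mult_right integrable_prod_inverse)

lemma schwartz_bounded: "f \<in> schwartz \<Longrightarrow> norm (f x) \<le> schwartz_seminorm (\<lambda>_. 0) [] f"
  using norm_monomial_le_seminorm[of f "\<lambda>_. 0" x "[]"] by (simp add: monomial_def)

text \<open>Fubini applied to \<open>F (x + v) - F x = \<integral>\<^sub>0\<^sup>1 F' (x + t v) dt\<close>: the integral over \<open>x\<close> of the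
  left-hand side vanishes by translation invariance.\<close>

lemma integral_directional_derivative_eq_0:
  fixes F F' :: "'a::euclidean_space \<Rightarrow> complex"
  assumes F: "integrable lborel F" and F': "integrable lborel F'" and cont: "continuous_on UNIV F'"
    and deriv: "\<And>x t. ((\<lambda>t. F (x + t *\<^sub>R v)) has_vector_derivative F' (x + t *\<^sub>R v)) (at t)"
  shows "(LINT x|lborel. F' x) = 0"
proof -
  let ?G = "\<lambda>t x. indicator {0..1} t *\<^sub>R F' (x + t *\<^sub>R v)"
  have [measurable]: "F \<in> borel_measurable borel" "F' \<in> borel_measurable borel"
    using borel_measurable_integrable[OF F] borel_measurable_integrable[OF F'] by simp_all
  have inner: "(LINT t|lborel. ?G t x) = F (x + v) - F x" for x
  proof -
    have "((\<lambda>t. F' (x + t *\<^sub>R v)) has_integral (F (x + 1 *\<^sub>R v) - F (x + 0 *\<^sub>R v))) {0..1}"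
      by (intro fundamental_theorem_of_calculus has_vector_derivative_at_within[OF deriv]) simp
    moreover have "set_integrable lborel {0..1} (\<lambda>t. F' (x + t *\<^sub>R v))"
      by (intro borel_integrable_atLeastAtMost' continuous_intros continuous_on_compose2[OF cont]) auto
    ultimately have "(LINT t:{0..1}|lborel. F' (x + t *\<^sub>R v)) = F (x + 1 *\<^sub>R v) - F (x + 0 *\<^sub>R v)"
      by (simp only: set_borel_integral_eq_integral(2) integral_unique)
    then show ?thesis
      by (simp add: set_lebesgue_integral_def)
  qed
  have "integrable (lborel \<Otimes>\<^sub>M lborel) (\<lambda>(t, x). ?G t x)"
  proof (rule lborel_pair.Fubini_integrable)
    have "(LINT x|lborel. norm (?G t x)) = indicator {0..1} t * (LINT x|lborel. norm (F' x))" for t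
      using lborel_integral_translate(2)[of "\<lambda>x. norm (F' x)" "t *\<^sub>R v"] by simp
    then show "integrable lborel (\<lambda>t. LINT x|lborel. norm (case (t, x) of (t, x) \<Rightarrow> ?G t x))"
      by (simp only: prod.case) simp
  qed (auto simp: lborel_integral_translate F')
  note Fub = lborel_pair.Fubini_integral[OF this]
  have "0 = (LINT x|lborel. F (x + v) - F x)"
    by (subst Bochner_Integration.integral_diff) (auto simp: lborel_integral_translate F)
  also have "\<dots> = (LINT t|lborel. LINT x|lborel. ?G t x)"
    unfolding Fub[symmetric] inner ..
  also have "\<dots> = (LINT t|lborel. indicator {0..1} (t::real) *\<^sub>R (LINT x|lborel. F' x))"
    by (simp add: lborel_integral_translate)
  also have "\<dots> = (LINT x|lborel. F' x)"
    by simp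
  finally show ?thesis ..
qed

section \<open>Fourier transforms of Schwartz functions\<close>

text \<open>Integration by parts: by the product rule \<open>?F'\<close> is the derivative of
  \<open>?F\<close> in direction \<open>j\<close>, so its integral vanishes, and splitting that
  integral gives the formula.\<close>

lemma ft_partial_deriv:
  assumes f: "f \<in> schwartz"
  shows "ft (partial_deriv j f) \<xi> = \<i> * of_real (\<xi> $ j) * ft f \<xi>"
proof -
  let ?d = "partial_deriv j f"
  let ?F = "\<lambda>x. cis (- (x \<bullet> \<xi>)) * f x"
  let ?F' = "\<lambda>x. cis (- (x \<bullet> \<xi>)) * ?d x - \<i> * of_real (\<xi> $ j) * (cis (- (x \<bullet> \<xi>)) * f x)"
  note d = schwartz_partial_deriv[OF f, of j]
  have i1: "integrable lborel ?F" and i2: "integrable lborel (\<lambda>x. cis (- (x \<bullet> \<xi>)) * ?d x)"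
    by (intro integrable_cis_mult schwartz_integrable f d; measurable)+
  have deriv: "((\<lambda>t. ?F (x + t *\<^sub>R axis j 1)) has_vector_derivative ?F' (x + t *\<^sub>R axis j 1)) (at t)" for x t
  proof -
    let ?y = "x + t *\<^sub>R axis j 1"
    have v: "((\<lambda>t. x + t *\<^sub>R axis j 1) has_vector_derivative axis j 1) (at t)"
      by (auto intro!: derivative_eq_intros)
    have "(f has_derivative frechet_derivative f (at ?y)) (at ?y)"
      using schwartz_differentiable[OF f] by (simp add: frechet_derivative_works)
    then have 1: "((\<lambda>t. f (x + t *\<^sub>R axis j 1)) has_vector_derivative ?d ?y) (at t)"
      using vector_derivative_diff_chain_within[OF v, of f] has_derivative_at_withinI
      by (force simp: o_def partial_deriv_def)
    have "((\<lambda>t. - ((x + t *\<^sub>R axis j 1) \<bullet> \<xi>)) has_derivative (\<lambda>s. s * (- \<xi> $ j))) (at t)"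
      by (auto intro!: derivative_eq_intros simp: inner_axis')
    from has_derivative_cis[OF this]
    have 2: "((\<lambda>t. cis (- ((x + t *\<^sub>R axis j 1) \<bullet> \<xi>))) has_vector_derivative
        - \<i> * of_real (\<xi> $ j) * cis (- (?y \<bullet> \<xi>))) (at t)"
      unfolding has_vector_derivative_def
      by (simp add: scaleR_conv_of_real ac_simps del: inner_simps)
    show ?thesis
      using has_vector_derivative_mult[OF 2 1] by (simp add: algebra_simps)
  qed
  have "(LINT x|lborel. ?F' x) = 0"
  proof (rule integral_directional_derivative_eq_0[OF i1 _ _ deriv])
    show "continuous_on UNIV ?F'"
      by (intro continuous_intros schwartz_continuous d f)
  qed (intro Bochner_Integration.integrable_diff integrable_mult_right i1 i2)
  then show ?thesis
    unfolding ft_def using i1 i2 by simp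
qed

lemma ft_linear_comb:
  assumes "integrable lborel f" "integrable lborel g"
  shows "ft (\<lambda>x. a * f x + b * g x) \<xi> = a * ft f \<xi> + b * ft g \<xi>"
proof -
  have "integrable lborel (\<lambda>x. cis (- (x \<bullet> \<xi>)) * f x)" "integrable lborel (\<lambda>x. cis (- (x \<bullet> \<xi>)) * g x)"
    by (auto intro!: integrable_cis_mult assms)
  then show ?thesis
    unfolding ft_def by (simp add: distrib_left mult.left_commute[of "cis _"])
qed

text \<open>The sign makes the Fourier multiplier +|\<xi>|^2, so that this function can serve as
  \<open>g\<close> above.\<close>

definition neg_laplacian :: "(real^3 \<Rightarrow> complex) \<Rightarrow> real^3 \<Rightarrow> complex" where
  "neg_laplacian f x = - (\<Sum>j\<in>UNIV. partial_deriv j (partial_deriv j f) x)"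

lemma schwartz_neg_laplacian:
  assumes "f \<in> schwartz"
  shows "neg_laplacian f \<in> schwartz"
proof -
  have "(\<lambda>x. -1 * ((partial_deriv 1 (partial_deriv 1 f) x + partial_deriv 2 (partial_deriv 2 f) x)
      + partial_deriv 3 (partial_deriv 3 f) x)) \<in> schwartz"
    by (intro schwartz_cmult schwartz_add schwartz_partial_deriv assms)
  then show ?thesis
    by (simp add: neg_laplacian_def[abs_def] sum_3)
qed

lemma ft_neg_laplacian:
  assumes f: "f \<in> schwartz"
  shows "ft (neg_laplacian f) \<xi> = (norm \<xi>)\<^sup>2 *\<^sub>R ft f \<xi>"
proof -
  let ?d = "\<lambda>j. partial_deriv j (partial_deriv j f)"
  have i: "integrable lborel (\<lambda>x. cis (- (x \<bullet> \<xi>)) * ?d j x)" for j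
    by (intro integrable_cis_mult schwartz_integrable schwartz_partial_deriv f) measurable
  have "ft (neg_laplacian f) \<xi> = - (\<Sum>j\<in>UNIV. ft (?d j) \<xi>)"
    unfolding ft_def neg_laplacian_def using i by (simp add: sum_distrib_left)
  also have "\<dots> = (\<Sum>j\<in>UNIV. of_real ((\<xi> $ j)\<^sup>2) * ft f \<xi>)"
    unfolding sum_negf[symmetric]
  proof (intro sum.cong refl)
    have "- (\<i> * c * (\<i> * c * z)) = c\<^sup>2 * z" for c z :: complex
      by (simp add: complex_eq_iff power2_eq_square algebra_simps)
    then show "- ft (?d j) \<xi> = of_real ((\<xi> $ j)\<^sup>2) * ft f \<xi>" for j
      unfolding ft_partial_deriv[OF schwartz_partial_deriv[OF f]] ft_partial_deriv[OF f] of_real_power .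
  qed
  also have "\<dots> = of_real ((norm \<xi>)\<^sup>2) * ft f \<xi>"
    by (simp add: norm_vec_def L2_set_def sum_nonneg sum_distrib_right)
  finally show ?thesis
    by (simp add: scaleR_conv_of_real)
qed

text \<open>The operator 1 minus the Laplacian, \<open>A\<close>, multiplies the transform by 1 +
  |\<xi>|^2. The transform of an iterate of \<open>A\<close> on \<open>f\<close> is bounded by the
  iterate's L1 norm, which forces decay of \<open>ft f\<close>.\<close>

lemma integrable_ft_schwartz:
  assumes f: "f \<in> schwartz"
  shows "integrable lborel (ft f)"
proof -
  define A where "A g = (\<lambda>x. 1 * g x + 1 * neg_laplacian g x)" for g
  have A: "A g \<in> schwartz" if "g \<in> schwartz" for g
    unfolding A_def by (intro schwartz_linear_comb schwartz_neg_laplacian that)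
  have ft_A: "ft (A g) \<xi> = of_real (1 + (norm \<xi>)\<^sup>2) * ft g \<xi>" if "g \<in> schwartz" for g \<xi>
    unfolding A_def
    by (subst ft_linear_comb)
      (simp_all add: schwartz_integrable schwartz_neg_laplacian ft_neg_laplacian that
        scaleR_conv_of_real algebra_simps)
  \<comment> \<open>One application per coordinate: (1+|\<xi>|^2)^3 dominates the product of the 1 +
    \<xi>_i^2, whose reciprocal is integrable.\<close>
  let ?g = "A (A (A f))"
  let ?I = "LINT x|lborel. norm (?g x)"
  have le: "norm (ft f \<xi>) \<le> ?I * (\<Prod>i\<in>UNIV. 1 / (1 + (\<xi> $ i)\<^sup>2))" for \<xi>
  proof -
    have "(\<Prod>i\<in>UNIV. 1 + (\<xi> $ i)\<^sup>2) \<le> (\<Prod>i\<in>(UNIV::3 set). 1 + (norm \<xi>)\<^sup>2)"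
    proof (intro prod_mono conjI)
      show "1 + (\<xi> $ i)\<^sup>2 \<le> 1 + (norm \<xi>)\<^sup>2" for i
        using component_le_norm_cart[of \<xi> i] by (simp add: abs_le_square_iff[symmetric])
    qed auto
    also have "\<dots> = (1 + (norm \<xi>)\<^sup>2) ^ 3"
      by simp
    finally have "(\<Prod>i\<in>UNIV. 1 + (\<xi> $ i)\<^sup>2) * norm (ft f \<xi>) \<le> (1 + (norm \<xi>)\<^sup>2) ^ 3 * norm (ft f \<xi>)"
      by (intro mult_right_mono) auto
    also have "\<dots> = norm (ft ?g \<xi>)"
      by (simp add: ft_A A f norm_mult power3_eq_cube mult.assoc del: of_real_add)
    also have "\<dots> \<le> ?I"
      by (rule norm_ft_le)
    finally have "(\<Prod>i\<in>UNIV. 1 + (\<xi> $ i)\<^sup>2) * norm (ft f \<xi>) \<le> ?I" .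
    moreover have "(\<Prod>i\<in>UNIV. 1 + (\<xi> $ i)\<^sup>2) > 0"
      by (intro prod_pos) (simp add: add_pos_nonneg)
    ultimately have "norm (ft f \<xi>) \<le> ?I / (\<Prod>i\<in>UNIV. 1 + (\<xi> $ i)\<^sup>2)"
      by (simp add: pos_le_divide_eq mult.commute)
    then show ?thesis
      by (simp add: prod_dividef)
  qed
  show ?thesis
  proof (rule Bochner_Integration.integrable_bound)
    show "integrable lborel (\<lambda>\<xi>::real^3. ?I * (\<Prod>i\<in>UNIV. 1 / (1 + (\<xi> $ i)\<^sup>2)))"
      by (intro integrable_mult_right integrable_prod_inverse)
    show "AE \<xi> in lborel. norm (ft f \<xi>) \<le> norm (?I * (\<Prod>i\<in>UNIV. 1 / (1 + (\<xi> $ i)\<^sup>2)))"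
      using order_trans[OF le abs_ge_self] by (intro AE_I2) simp
  qed (use schwartz_measurable[OF f] in measurable)
qed

section \<open>Plane waves\<close>

lemma exp_i_times_eq_cis: "exp (\<i> * complex_of_real t) = cis t" "exp (- \<i> * complex_of_real t) = cis (- t)"
  by (simp_all add: cis_conv_exp)

lemma plane_wave_eq: "plane_wave k x = cis (x \<bullet> k)"
  unfolding plane_wave_def exp_i_times_eq_cis ..

lemma measurable_plane_wave [measurable]: "plane_wave k \<in> borel_measurable borel"
  unfolding plane_wave_eq[abs_def] by measurable

lemma fourier_eq_ft:
  assumes [measurable]: "f \<in> borel_measurable borel"
  shows "fourier f \<xi> = complex_of_real ((2 * pi) powr (-3/2)) * ft f \<xi>"
  unfolding fourier_def ft_def exp_i_times_eq_cis by (subst integral_completion) simp_all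

text \<open>Both Fourier transforms carry a factor \<open>(2\<pi>)\<^bsup>-3/2\<^esup>\<close>, hence the constant.\<close>

lemma sqrt_neg_laplacian_eq:
  assumes [measurable]: "\<psi> \<in> borel_measurable borel"
  shows "sqrt_neg_laplacian \<psi> x =
    (LINT \<xi>|lborel. cis (x \<bullet> \<xi>) * (norm \<xi> *\<^sub>R ft \<psi> \<xi>)) /\<^sub>R (2 * pi) ^ 3"
proof -
  let ?c = "complex_of_real ((2 * pi) powr (-3/2))"
  have "sqrt_neg_laplacian \<psi> x = ?c * (LINT \<xi>|lborel. ?c * (cis (x \<bullet> \<xi>) * (norm \<xi> *\<^sub>R ft \<psi> \<xi>)))"
    unfolding sqrt_neg_laplacian_def inverse_fourier_def exp_i_times_eq_cis fourier_eq_ft[OF assms]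
    by (subst integral_completion) (simp_all add: scaleR_conv_of_real ac_simps)
  also have "\<dots> = (?c * ?c) * (LINT \<xi>|lborel. cis (x \<bullet> \<xi>) * (norm \<xi> *\<^sub>R ft \<psi> \<xi>))"
    by (simp only: integral_mult_right_zero mult.assoc)
  also have "?c * ?c = complex_of_real (inverse ((2 * pi) ^ 3))"
    unfolding of_real_mult[symmetric] powr_add[symmetric] by (simp add: powr_minus powr_numeral)
  finally show ?thesis
    by (simp add: scaleR_conv_of_real)
qed

section \<open>The half Laplacian of Schwartz functions and pairing with plane waves\<close>

lemma
  assumes \<psi>: "\<psi> \<in> schwartz"
  shows integrable_sqrt_neg_laplacian: "integrable lborel (sqrt_neg_laplacian \<psi>)"
    and ft_sqrt_neg_laplacian: "ft (sqrt_neg_laplacian \<psi>) k = norm k *\<^sub>R ft \<psi> k"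
proof -
  let ?h = "\<lambda>x. LINT \<xi>|lborel. cis (x \<bullet> \<xi>) * (norm \<xi> *\<^sub>R ft \<psi> \<xi>)"
  \<comment> \<open>The assumptions of \<open>integrable_half_laplacian\<close> in order, with the
    zeroth seminorm as \<open>B\<close> and \<open>neg_laplacian \<psi>\<close> as
    \<open>g\<close>.\<close>
  note hyps = schwartz_integrable[OF \<psi>] schwartz_continuous[OF \<psi>] schwartz_bounded[OF \<psi>]
    integrable_ft_schwartz[OF \<psi>] schwartz_integrable[OF schwartz_neg_laplacian[OF \<psi>]]
    ft_neg_laplacian[OF \<psi>] integrable_ft_schwartz[OF schwartz_neg_laplacian[OF \<psi>]]
  have eq: "sqrt_neg_laplacian \<psi> = (\<lambda>x. ?h x /\<^sub>R (2 * pi) ^ 3)"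
    using sqrt_neg_laplacian_eq[OF schwartz_measurable[OF \<psi>]] by blast
  show "integrable lborel (sqrt_neg_laplacian \<psi>)"
    unfolding eq by (intro integrable_scaleR_right integrable_half_laplacian[OF hyps])
  have "ft (sqrt_neg_laplacian \<psi>) k = ft ?h k /\<^sub>R (2 * pi) ^ 3"
    unfolding eq ft_def mult_scaleR_right integral_scaleR_right ..
  then show "ft (sqrt_neg_laplacian \<psi>) k = norm k *\<^sub>R ft \<psi> k"
    unfolding ft_half_laplacian[OF hyps] by simp
qed

text \<open>The plane wave is conjugate to the character in \<open>ft\<close>, hence -k. The sign
  later disappears from the multiplier, as -k and k have the same norm.\<close>

lemma integral_plane_wave_mult:
  assumes [measurable]: "f \<in> borel_measurable borel"
  shows "(LINT x|lebesgue. plane_wave k x * f x) = ft f (- k)"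
  by (subst integral_completion) (simp_all add: ft_def plane_wave_eq)

lemma integrable_plane_wave_mult:
  assumes "integrable lborel f"
  shows "integrable lebesgue (\<lambda>x. plane_wave k x * f x)"
proof -
  have [measurable]: "f \<in> borel_measurable borel"
    using borel_measurable_integrable[OF assms] by simp
  have "integrable lborel (\<lambda>x. cis (x \<bullet> k) * f x)"
    by (intro integrable_cis_mult assms) measurable
  then show ?thesis
    by (subst integrable_completion) (simp_all add: plane_wave_eq)
qed

section \<open>Plane waves in a weighted space\<close>

lemma integrable_1_plus_power2_powr:
  "integrable lborel (\<lambda>t::real. (1 + t\<^sup>2) powr (-3/4))"
proof -
  \<comment> \<open>The comparison function has the antiderivative -2 (1+t)^(-1/2) on the half-line;
    adding its reflection covers the whole line.\<close>
  let ?g = "\<lambda>t::real. (1 + t) powr (-3/2) * indicator {0..} t"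
  have nonneg: "?g t \<ge> 0" for t
    by simp
  have "(\<integral>\<^sup>+t. ennreal ((1 + t) powr (-3/2)) * indicator {0..} t \<partial>lborel) = ennreal (0 - (- 2 * (1 + 0) powr (-1/2)))"
  proof (rule nn_integral_FTC_atLeast)
    show "((\<lambda>t. - 2 * (1 + t) powr (-1/2)) has_real_derivative (1 + t) powr (-3/2)) (at t)"
      if "0 \<le> t" for t :: real
      using that by (auto intro!: derivative_eq_intros)
    show "((\<lambda>t::real. - 2 * (1 + t) powr (-1/2)) \<longlongrightarrow> 0) at_top"
      by real_asymp
  qed auto
  then have "(\<integral>\<^sup>+t. ennreal (?g t) \<partial>lborel) < \<infinity>"
    by (simp add: ennreal_mult'' ennreal_indicator)
  then have g: "integrable lborel ?g"
    by (intro integrableI_nonneg) auto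
  have "integrable lborel (\<lambda>t. 2 * (?g t + ?g (0 + (-1) * t)))"
    by (intro integrable_mult_right Bochner_Integration.integrable_add g lborel_integrable_real_affine) simp
  then show ?thesis
  proof (rule Bochner_Integration.integrable_bound)
    have "(1 + t\<^sup>2) powr (-3/4) \<le> 2 * (1 + \<bar>t\<bar>) powr (-3/2)" for t :: real
    proof -
      \<comment> \<open>A rearrangement of (1-|t|)^2 \<ge> 0. The negative power reverses it and
        leaves the constant 2^(3/4), rounded up to 2.\<close>
      have "(1 + \<bar>t\<bar>)\<^sup>2 / 2 \<le> 1 + t\<^sup>2"
        using zero_le_power2[of "1 - \<bar>t\<bar>"] by (simp add: power2_eq_square algebra_simps)
      then have "(1 + t\<^sup>2) powr (-3/4) \<le> ((1 + \<bar>t\<bar>)\<^sup>2 / 2) powr (-3/4)"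
        by (intro powr_mono2') auto
      also have "\<dots> = 2 powr (3/4) * (1 + \<bar>t\<bar>) powr (-3/2)"
      proof -
        have 1: "((1 + \<bar>t\<bar>)\<^sup>2) powr (-3/4) = (1 + \<bar>t\<bar>) powr (-3/2)"
          using powr_powr[of "1 + \<bar>t\<bar>" 2 "-3/4"] by (simp add: powr_numeral)
        have 2: "inverse (2 powr (-3/4)) = (2::real) powr (3/4)"
          using powr_minus[of "2::real" "-3/4"] by simp
        show ?thesis
          unfolding 1[symmetric] 2[symmetric]
          by (simp only: powr_divide zero_le_power2 zero_le_numeral
              divide_inverse_commute[of "((1 + \<bar>t\<bar>)\<^sup>2) powr (-3/4)"])
      qed
      also have "\<dots> \<le> 2 powr 1 * (1 + \<bar>t\<bar>) powr (-3/2)"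
        by (intro mult_right_mono powr_mono) auto
      finally show ?thesis
        by simp
    qed
    moreover have "(1 + \<bar>t\<bar>) powr (-3/2) \<le> ?g t + ?g (0 + (-1) * t)" for t
      by (cases "t \<ge> 0") (auto simp: indicator_def)
    ultimately have "(1 + t\<^sup>2) powr (-3/4) \<le> 2 * (?g t + ?g (0 + (-1) * t))" for t
      by (meson mult_left_mono order_trans zero_le_numeral)
    then show "AE t in lborel. norm ((1 + t\<^sup>2) powr (-3/4)) \<le> norm (2 * (?g t + ?g (0 + (-1) * t)))"
      unfolding real_norm_def abs_of_nonneg[OF powr_ge_zero]
      by (intro AE_I2 order_trans[OF _ abs_ge_self])
  qed measurable
qed

text \<open>The exponent -9/4 lies between -5/2, required for duality, and -3/2, required for
  integrability. It splits into three exponents -3/4, one per coordinate, since |x_i| \<le>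
  |x|.\<close>

lemma plane_wave_in_weighted_L2: "plane_wave k \<in> weighted_L2 (-9/4)"
proof -
  have "integrable lborel (\<lambda>x::real^3. (1 + (norm x)\<^sup>2) powr (-9/4))"
  proof (rule Bochner_Integration.integrable_bound)
    show "integrable lborel (\<lambda>x::real^3. \<Prod>i\<in>UNIV. (1 + (x $ i)\<^sup>2) powr (-3/4))"
      using lborel_integral_prod(1)[of "\<lambda>_::real^3. \<lambda>t. (1 + t\<^sup>2) powr (-3/4)", OF integrable_1_plus_power2_powr]
      unfolding prod_Basis_vec[of "\<lambda>t. (1 + t\<^sup>2) powr (-3/4)"] .
    have "(1 + (norm x)\<^sup>2) powr (-9/4) \<le> (\<Prod>i\<in>UNIV. (1 + (x $ i)\<^sup>2) powr (-3/4))" for x :: "real^3"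
    proof -
      have "(1 + (norm x)\<^sup>2) powr (-9/4) = (\<Prod>i\<in>(UNIV::3 set). (1 + (norm x)\<^sup>2) powr (-3/4))"
        by (simp add: power3_eq_cube flip: powr_add)
      also have "\<dots> \<le> (\<Prod>i\<in>UNIV. (1 + (x $ i)\<^sup>2) powr (-3/4))"
      proof (intro prod_mono conjI powr_mono2')
        show "1 + (x $ i)\<^sup>2 \<le> 1 + (norm x)\<^sup>2" for i
          using component_le_norm_cart[of x i] by (simp add: abs_le_square_iff[symmetric])
      qed (auto simp: add_pos_nonneg)
      finally show ?thesis .
    qed
    then show "AE x in lborel. norm ((1 + (norm x)\<^sup>2) powr (-9/4)) \<le> norm (\<Prod>i\<in>UNIV. (1 + ((x::real^3) $ i)\<^sup>2) powr (-3/4))"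
      by (intro AE_I2) (simp add: prod_nonneg)
  qed measurable
  moreover have "(norm ((1 + (norm x)\<^sup>2) powr (-9/4 / 2) *\<^sub>R plane_wave k x))\<^sup>2 = (1 + (norm x)\<^sup>2) powr (-9/4)" for x
    by (simp add: plane_wave_eq power2_eq_square flip: powr_add)
  ultimately have "integrable lborel (\<lambda>x. (norm ((1 + (norm x)\<^sup>2) powr (-9/4 / 2) *\<^sub>R plane_wave k x))\<^sup>2)"
    by (simp only:)
  moreover have meas: "(\<lambda>x. (1 + (norm x)\<^sup>2) powr (-9/4 / 2) *\<^sub>R plane_wave k x) \<in> borel_measurable lborel"
    by measurable
  ultimately have "integrable lebesgue (\<lambda>x. (norm ((1 + (norm x)\<^sup>2) powr (-9/4 / 2) *\<^sub>R plane_wave k x))\<^sup>2)"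
    by (subst integrable_completion) measurable
  then show ?thesis
    unfolding weighted_L2_def square_integrable_def mem_Collect_eq
    using measurable_completion[OF meas] by (intro conjI)
qed

section \<open>Temperedness\<close>

lemma openin_schwartz_seminorm_ball:
  "f \<in> schwartz \<Longrightarrow> 0 < e \<Longrightarrow>
    openin schwartz_topology {g \<in> schwartz. schwartz_seminorm \<alpha> js (\<lambda>x. g x - f x) < e}"
  unfolding schwartz_topology_def by (rule topology_generated_by_Basis) blast

lemma topspace_schwartz_topology: "topspace schwartz_topology \<subseteq> schwartz"
  unfolding schwartz_topology_def topology_generated_by_topspace by blast

lemma schwartz_seminorm_zero: "schwartz_seminorm \<alpha> js (\<lambda>x. 0) = 0"
proof -
  have "partial_derivs js (\<lambda>_. 0) = (\<lambda>_. 0)"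
    by (induction js) (auto simp: partial_derivs_Cons partial_deriv_def)
  then show ?thesis
    by (simp add: schwartz_seminorm_def)
qed

text \<open>By linearity and the bound, \<open>T\<close> varies by less than \<open>e\<close> on a
  finite intersection of seminorm balls around \<open>f\<close>, and such an intersection is
  open.\<close>

lemma tempered_distributions_bounded:
  assumes ext: "T \<in> extensional schwartz"
    and add: "\<And>f g. f \<in> schwartz \<Longrightarrow> g \<in> schwartz \<Longrightarrow> T (\<lambda>x. f x + g x) = T f + T g"
    and scale: "\<And>c f. f \<in> schwartz \<Longrightarrow> T (\<lambda>x. c * f x) = c * T f"
    and P: "finite P" "P \<noteq> {}"
    and bound: "\<And>f. f \<in> schwartz \<Longrightarrow> norm (T f) \<le> C * (\<Sum>(\<alpha>, js)\<in>P. schwartz_seminorm \<alpha> js f)"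
  shows "T \<in> tempered_distributions"
proof -
  have diff: "T (\<lambda>x. g x - f x) = T g - T f" if "f \<in> schwartz" "g \<in> schwartz" for f g
    using add[OF that(2) schwartz_cmult[OF that(1)], of "-1"] scale[OF that(1), of "-1"] by simp
  have "openin schwartz_topology {f \<in> topspace schwartz_topology. T f \<in> U}" if "open U" for U
  proof (subst openin_subopen, clarify)
    fix f assume f: "f \<in> topspace schwartz_topology" "T f \<in> U"
    then have fs: "f \<in> schwartz"
      using topspace_schwartz_topology by blast
    obtain e where e: "e > 0" "\<And>z. dist z (T f) < e \<Longrightarrow> z \<in> U"
      using \<open>open U\<close> f(2) unfolding open_dist by blast
    \<comment> \<open>The absolute value allows negative \<open>C\<close>; adding 1 avoids division
      by zero and makes the final estimate strict.\<close>
    define d where "d = e / ((\<bar>C\<bar> + 1) * real (card P))"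
    have card: "real (card P) > 0"
      using P by (simp add: card_gt_0_iff)
    have d: "d > 0"
      using e card by (simp add: d_def)
    define V where "V = (\<Inter>(\<alpha>, js)\<in>P. {g \<in> schwartz. schwartz_seminorm \<alpha> js (\<lambda>x. g x - f x) < d})"
    have "openin schwartz_topology V"
      unfolding V_def using P openin_schwartz_seminorm_ball[OF fs d] by (intro openin_Inter) auto
    moreover have "f \<in> V"
      using fs d by (auto simp: V_def schwartz_seminorm_zero)
    moreover have "T g \<in> U" if "g \<in> V" for g
    proof -
      have gs: "g \<in> schwartz" and le: "\<And>\<alpha> js. (\<alpha>, js) \<in> P \<Longrightarrow> schwartz_seminorm \<alpha> js (\<lambda>x. g x - f x) < d"
        using that P(2) by (auto simp: V_def)
      let ?S = "\<Sum>(\<alpha>, js)\<in>P. schwartz_seminorm \<alpha> js (\<lambda>x. g x - f x)"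
      have "0 \<le> schwartz_seminorm \<alpha> js (\<lambda>x. g x - f x)" for \<alpha> js
        using order_trans[OF _ norm_monomial_le_seminorm[OF schwartz_diff[OF gs fs]]] by simp
      then have S: "?S \<ge> 0"
        by (intro sum_nonneg) auto
      have "norm (T g - T f) \<le> C * ?S"
        using bound[OF schwartz_diff[OF gs fs]] diff[OF fs gs] by simp
      also have "\<dots> \<le> \<bar>C\<bar> * ?S"
        using S by (intro mult_right_mono) auto
      also have "?S \<le> real (card P) * d"
        using le by (intro sum_bounded_above) (auto intro: less_imp_le)
      then have "\<bar>C\<bar> * ?S \<le> \<bar>C\<bar> * (real (card P) * d)"
        by (intro mult_left_mono) auto
      also have "\<dots> < (\<bar>C\<bar> + 1) * (real (card P) * d)"
        using card d by simp
      also have "\<dots> = e"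
        using card by (simp add: d_def)
      finally show ?thesis
        by (intro e(2)) (simp add: dist_norm)
    qed
    moreover have "V \<subseteq> topspace schwartz_topology"
      using \<open>openin schwartz_topology V\<close> by (rule openin_subset)
    ultimately show "\<exists>V. openin schwartz_topology V \<and> f \<in> V \<and> V \<subseteq> {f \<in> topspace schwartz_topology. T f \<in> U}"
      by blast
  qed
  then have "continuous_map schwartz_topology euclidean T"
    by (simp add: continuous_map)
  then show ?thesis
    using ext add scale by (simp add: tempered_distributions_def)
qed

lemma regular_distr_plane_wave:
  "\<psi> \<in> schwartz \<Longrightarrow> regular_distr (\<lambda>x. complex_of_real (norm k) * plane_wave k x) \<psi> = norm k *\<^sub>R ft \<psi> (- k)"
  by (simp add: regular_distr_def mult.assoc scaleR_conv_of_real
      integral_plane_wave_mult schwartz_measurable)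

text \<open>The functional is |k| times evaluation of \<open>ft\<close> at -k, bounded by the L1
  norm and hence by \<open>l1_seminorm\<close>.\<close>

lemma regular_distr_plane_wave_tempered:
  "regular_distr (\<lambda>x. complex_of_real (norm k) * plane_wave k x) \<in> tempered_distributions"
proof (rule tempered_distributions_bounded)
  let ?T = "regular_distr (\<lambda>x. complex_of_real (norm k) * plane_wave k x)"
  let ?I = "LINT x|lborel. (\<Prod>i\<in>UNIV. 1 / (1 + ((x::real^3) $ i)\<^sup>2))"
  let ?\<alpha> = "\<lambda>(S :: 3 set) i. if i \<in> S then 2 else 0 :: nat"
  let ?P = "range (\<lambda>S :: 3 set. (?\<alpha> S, [] :: 3 list))"
  show "?T \<in> extensional schwartz"
    by (simp add: regular_distr_def)
  show "finite ?P" "?P \<noteq> {}"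
    by auto
  have ft_le: "norm (ft f (- k)) \<le> l1_seminorm f * ?I" if "f \<in> schwartz" for f
    using norm_ft_le integral_norm_schwartz_le[OF that] by (rule order_trans)
  \<comment> \<open>Distinct subsets give distinct seminorms, so the sum over the set
    \<open>?P\<close> does not merge terms of \<open>l1_seminorm\<close>.\<close>
  have "inj ?\<alpha>"
  proof
    fix S S' :: "3 set" assume "?\<alpha> S = ?\<alpha> S'"
    then have "?\<alpha> S i = ?\<alpha> S' i" for i
      by (rule fun_cong)
    then have "i \<in> S \<longleftrightarrow> i \<in> S'" for i
      by (metis zero_neq_numeral)
    then show "S = S'"
      by blast
  qed
  then have "inj (\<lambda>S. (?\<alpha> S, [] :: 3 list))"
    by (auto simp: inj_def)
  then have sum: "(\<Sum>(\<alpha>, js)\<in>?P. schwartz_seminorm \<alpha> js f) = l1_seminorm f" for f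
    by (subst sum.reindex) (simp_all add: l1_seminorm_def)
  show "norm (?T f) \<le> norm k * ?I * (\<Sum>(\<alpha>, js)\<in>?P. schwartz_seminorm \<alpha> js f)" if "f \<in> schwartz" for f
    unfolding sum regular_distr_plane_wave[OF that]
    using mult_left_mono[OF ft_le[OF that], of "norm k"] by (simp add: ac_simps)
  show "?T (\<lambda>x. f x + g x) = ?T f + ?T g" if "f \<in> schwartz" "g \<in> schwartz" for f g
    using ft_linear_comb[of f g 1 1 "- k"] that
    by (simp add: regular_distr_plane_wave schwartz_add schwartz_integrable scaleR_right_distrib)
  show "?T (\<lambda>x. c * f x) = c * ?T f" if "f \<in> schwartz" for c f
    using ft_linear_comb[of f f c 0 "- k"] that
    by (simp add: regular_distr_plane_wave schwartz_cmult schwartz_integrable)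
qed

text \<open>The first two conjuncts ensure that the duality definition is meaningful: the plane wave
  lies in an admissible space, and no integral takes the default value 0 of a non-integrable
  function.\<close>

theorem lemma8p1:
  fixes k :: "real^3"
  shows "(\<exists>s > -5/2. plane_wave k \<in> weighted_L2 s) \<and>
    (\<forall>\<psi>\<in>schwartz. integrable lebesgue (\<lambda>x. plane_wave k x * sqrt_neg_laplacian \<psi> x)) \<and>
    sqrt_neg_laplacian_distr (plane_wave k) \<in> tempered_distributions \<and>
    sqrt_neg_laplacian_distr (plane_wave k) =
      regular_distr (\<lambda>x. complex_of_real (norm k) * plane_wave k x)"
proof -
  have "sqrt_neg_laplacian_distr (plane_wave k) =
      regular_distr (\<lambda>x. complex_of_real (norm k) * plane_wave k x)" (is "?S = ?R")
  proof
    fix \<psi> show "?S \<psi> = ?R \<psi>"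
    \<comment> \<open>On test functions both sides equal |k| times \<open>ft \<psi> (- k)\<close>;
      elsewhere both are \<open>undefined\<close>.\<close>
    proof (cases "\<psi> \<in> schwartz")
      case True
      then have "?S \<psi> = ft (sqrt_neg_laplacian \<psi>) (- k)"
        using borel_measurable_integrable[OF integrable_sqrt_neg_laplacian[OF True]]
        by (simp add: sqrt_neg_laplacian_distr_def integral_plane_wave_mult)
      also have "\<dots> = ?R \<psi>"
        using True by (simp add: ft_sqrt_neg_laplacian regular_distr_plane_wave)
      finally show ?thesis .
    next
      case False
      then show ?thesis
        by (simp add: sqrt_neg_laplacian_distr_def regular_distr_def)
    qed
  qed
  moreover have "\<exists>s > -5/2. plane_wave k \<in> weighted_L2 s"
    by (rule exI[of _ "-9/4"]) (simp add: plane_wave_in_weighted_L2[simplified])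
  \<comment> \<open>Temperedness, proved for the right-hand side, transfers along the
    equality.\<close>
  ultimately show ?thesis
    using regular_distr_plane_wave_tempered integrable_plane_wave_mult[OF integrable_sqrt_neg_laplacian]
    by auto
qed

end
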